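(* Every maximum affine equiangular set in $L$ with norm $3$ with respect to the switching root $\rho$ is maximal in $\mathbb{R}L$; that is, there is no affine equiangular set in $\mathbb{R}L$ with norm $3$ with respect to $\rho$ properly containing it.
   Context: Lattices. $A_n=\{x\in\mathbb{Z}^{n+1}: x_1+\cdots+x_{n+1}=0\}$ and $\alpha_n=(\frac1{n+1},\dots,\frac1{n+1},-\frac n{n+1})\in\mathbb{R}^{n+1}$ (so $\alpha_1=(\frac12,-\frac12)$). Let $\Lambda=A_5^3\oplus A_1^4\subset\mathbb{R}^{26}$; vectors of $\mathbb{R}^{26}$ are written $(v_1,\dots,v_7)$ with $v_1,v_2,v_3\in\mathbb{R}^6$ and $v_4,\dots,v_7\in\mathbb{R}^2$. Let $\beta_0=(\alpha_5,\alpha_5,\alpha_5,0,0,0,\alpha_1)$, $\beta_1=(3\alpha_5,0,0,0,\alpha_1,\alpha_1,\alpha_1)$, $\beta_2=(0,3\alpha_5,0,\alpha_1,0,\alpha_1,\alpha_1)$, $\beta_3=(0,0,3\alpha_5,\alpha_1,\alpha_1,0,\alpha_1)$. $L$ is the lattice generated by $\Lambda$ and $\beta_0,\beta_1,\beta_2,\beta_3$ (an integral lattice), and $\mathbb{R}L$ is its real span (of dimension $19$). Let $\rho=(0,0,0,0,0,0,2\alpha_1)$. Affine equiangular sets. A set $\omega$ of vectors is an affine equiangular set with norm $3$ with respect to the switching root $\rho$ if $(u,\rho)=1$ and $(u,u)=3$ for all $u\in\omega$, and $(u,v)\in\{0,1\}$ for all distinct $u,v\in\omega$, where $(\cdot,\cdot)$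 is the standard inner product. It is in a set $V$ if $\omega\subset V$. It is maximum in $L$ if no such set in $L$ has larger cardinality. *)

theory Defs
  imports "HOL-Analysis.Analysis" "HOL-Library.Equipollence"
begin

text \<open>The splitting of a vector of the 26-dimensional space into seven blocks is built into the type.
  The inner product of a product type is the sum of the inner products of the components, so
  this is Euclidean 26-space with its standard inner product.\<close>

type_synonym R26 =
  "(real^6) \<times> (real^6) \<times> (real^6) \<times> (real^2) \<times> (real^2) \<times> (real^2) \<times> (real^2)"

text \<open>The root lattice of type A whose rank is one less than the number of coordinates.\<close>

definition root_lattice_A :: "(real^'n) set" where
  "root_lattice_A = {x. (\<forall>i. x $ i \<in> \<int>) \<and> (\<Sum>i\<in>UNIV. x $ i) = 0}"

definition alpha5 :: "real^6" where
  "alpha5 = vector [1/6, 1/6, 1/6, 1/6, 1/6, -5/6]"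

definition alpha1 :: "real^2" where
  "alpha1 = vector [1/2, -1/2]"

definition int_span :: "'a::real_vector set \<Rightarrow> 'a set" where
  "int_span S = {\<Sum>v\<in>T. of_int (c v) *\<^sub>R v | T (c :: 'a \<Rightarrow> int). finite T \<and> T \<subseteq> S}"

definition Lambda :: "R26 set" where
  "Lambda = root_lattice_A \<times> root_lattice_A \<times> root_lattice_A \<times>
     root_lattice_A \<times> root_lattice_A \<times> root_lattice_A \<times> root_lattice_A"

definition beta0 :: R26 where
  "beta0 = (alpha5, alpha5, alpha5, 0, 0, 0, alpha1)"

definition beta1 :: R26 where
  "beta1 = (3 *\<^sub>R alpha5, 0, 0, 0, alpha1, alpha1, alpha1)"

definition beta2 :: R26 where
  "beta2 = (0, 3 *\<^sub>R alpha5, 0, alpha1, 0, alpha1, alpha1)"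

definition beta3 :: R26 where
  "beta3 = (0, 0, 3 *\<^sub>R alpha5, alpha1, alpha1, 0, alpha1)"

definition L :: "R26 set" where
  "L = int_span (Lambda \<union> {beta0, beta1, beta2, beta3})"

definition rho :: R26 where
  "rho = (0, 0, 0, 0, 0, 0, 2 *\<^sub>R alpha1)"

definition affine_equiangular3 :: "'a::real_inner \<Rightarrow> 'a set \<Rightarrow> bool" where
  "affine_equiangular3 r \<omega> \<longleftrightarrow>
     (\<forall>u\<in>\<omega>. u \<bullet> r = 1 \<and> u \<bullet> u = 3) \<and>
     (\<forall>u\<in>\<omega>. \<forall>v\<in>\<omega>. u \<noteq> v \<longrightarrow> u \<bullet> v \<in> {0, 1})"

text \<open>Cardinalities are compared by injections (\<open>A \<prec> B\<close> says that B is strictly larger than A), since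
  \<^const>\<open>card\<close> is 0 on infinite sets and finiteness is not part of the definition above.\<close>

definition maximum_affine_equiangular3_in ::
    "'a::real_inner set \<Rightarrow> 'a \<Rightarrow> 'a set \<Rightarrow> bool" where
  "maximum_affine_equiangular3_in V r \<omega> \<longleftrightarrow>
     affine_equiangular3 r \<omega> \<and> \<omega> \<subseteq> V \<and>
     \<not> (\<exists>\<omega>'. affine_equiangular3 r \<omega>' \<and> \<omega>' \<subseteq> V \<and> \<omega> \<prec> \<omega>')"

definition maximal_affine_equiangular3_in ::
    "'a::real_inner set \<Rightarrow> 'a \<Rightarrow> 'a set \<Rightarrow> bool" where
  "maximal_affine_equiangular3_in V r \<omega> \<longleftrightarrow>
     affine_equiangular3 r \<omega> \<and> \<omega> \<subseteq> V \<and>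
     \<not> (\<exists>\<omega>'. affine_equiangular3 r \<omega>' \<and> \<omega>' \<subseteq> V \<and> \<omega> \<subset> \<omega>')"

end

theory Submission
  imports Defs
begin

text \<open>The norm-3 vectors of \<open>L\<close> with inner product 1 with \<open>\<rho>\<close> are, up to \<open>u \<mapsto> \<rho> - u\<close>, of two kinds:
  triples of minimal vectors of class 1, one in each \<open>A\<^sub>5\<close> block, and, for each \<open>A\<^sub>5\<close> block, vectors
  \<open>s\<close> with entries \<open>\<plusminus>1/2\<close> together with \<open>\<plusminus>\<alpha>\<^sub>1\<close> in two of the \<open>A\<^sub>1\<close> blocks. The triples in an affine equiangular
  set form a partial Latin square of order 6, so there are at most 36 of them, and at most \<open>4 + 3 = 7\<close> vectors of the
  second kind fit into each block. All vectors of different kinds are compatible, so the maximum is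
  \<open>36 + 3 \<cdot> 7 = 57\<close>, and a maximum set is extremal in each of the four parts.

  Let \<open>x = (p, q, r, t\<^sub>1\<alpha>\<^sub>1, t\<^sub>2\<alpha>\<^sub>1, t\<^sub>3\<alpha>\<^sub>1, \<alpha>\<^sub>1)\<close> in the real span extend a maximum set. Summing the 36 equations
  \<open>(p\<^sub>i + q\<^sub>j + r\<^sub>k)\<^sup>2 = 1/4\<close> of the Latin square gives \<open>|p|\<^sup>2 + |q|\<^sup>2 + |r|\<^sup>2 = 3/2\<close>, hence
  \<open>t\<^sub>1\<^sup>2 + t\<^sub>2\<^sup>2 + t\<^sub>3\<^sup>2 = 2\<close>. The seven vectors of each \<open>A\<^sub>5\<close> block force \<open>t\<^sub>i\<^sup>2 + t\<^sub>j\<^sup>2 < 4/3\<close> for the two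
  coordinates they involve, and adding the three inequalities gives the contradiction \<open>4 < 4\<close>.\<close>

section \<open>Obtuse systems of half-sign vectors\<close>

definition half_signs :: "(real^'n) set" where
  "half_signs = {s. (\<forall>i. s $ i = 1/2 \<or> s $ i = - 1/2) \<and> (\<Sum>i\<in>UNIV. s $ i) = 0}"

lemma UNIV_6: "(UNIV :: 6 set) = {0, 1, 2, 3, 4, 5}"
proof -
  have "card {0, 1, 2, 3, 4, 5 :: 6} = card (UNIV :: 6 set)" by simp
  then show ?thesis by (metis card_subset_eq finite subset_UNIV)
qed

lemma finite_half_signs: "finite (half_signs :: (real^'n) set)"
proof (rule finite_subset)
  show "(half_signs :: (real^'n) set) \<subseteq> range (\<lambda>S. \<chi> i. if i \<in> S then 1/2 else - 1/2)"
  proof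
    fix s :: "real^'n" assume "s \<in> half_signs"
    then have "s = (\<chi> i. if i \<in> {i. s $ i = 1/2} then 1/2 else - 1/2)"
      by (auto simp: half_signs_def vec_eq_iff)
    then show "s \<in> range (\<lambda>S. \<chi> i. if i \<in> S then 1/2 else - 1/2)" by blast
  qed
qed simp

lemma half_signs_square: "s \<in> half_signs \<Longrightarrow> s $ i * s $ i = 1/4"
proof -
  assume "s \<in> half_signs"
  then have "s $ i = 1/2 \<or> s $ i = - 1/2" by (simp add: half_signs_def)
  then show ?thesis by (elim disjE; simp only:; simp)
qed

lemma half_signs_inner_self:
  fixes s :: "real^6"
  assumes "s \<in> half_signs"
  shows "s \<bullet> s = 3/2"
  using assms by (simp add: inner_vec_def half_signs_square)

text \<open>After adding 1/2, the entries of \<open>s\<close> and \<open>t\<close> are 0 or 1, so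
  the sum of their products counts the common positive coordinates. It equals
  \<open>s \<bullet> t + 3/2\<close>, because both coordinate sums vanish.\<close>

lemma half_signs_inner_common:
  fixes s t :: "real^6"
  assumes s: "s \<in> half_signs" and t: "t \<in> half_signs" and ij: "i \<noteq> j"
    and eq: "s $ i = 1/2" "t $ i = 1/2" "s $ j = 1/2" "t $ j = 1/2"
  shows "s \<bullet> t \<ge> 1/2"
proof -
  have nn: "(s $ k + 1/2) * (t $ k + 1/2) \<ge> 0" for k
    using s t unfolding half_signs_def by (auto dest!: spec[of _ k])
  have "(\<Sum>k\<in>{i,j}. (s $ k + 1/2) * (t $ k + 1/2)) \<le> (\<Sum>k\<in>UNIV. (s $ k + 1/2) * (t $ k + 1/2))"
    by (rule sum_mono2) (use nn in auto)
  moreover have "(\<Sum>k\<in>UNIV. (s $ k + 1/2) * (t $ k + 1/2)) = s \<bullet> t + 3/2"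
    using s t by (simp add: half_signs_def inner_vec_def algebra_simps sum.distrib
        flip: sum_divide_distrib)
  ultimately show ?thesis using ij eq by simp
qed

text \<open>For \<open>n\<close> vectors, expanding the square bounds the squared norm of the sum by
  3n/2 - n(n-1)/2 = n(4-n)/2. This is negative for n > 4 and zero for n = 4.\<close>

lemma obtuse_sum:
  fixes A :: "(real^6) set"
  assumes A: "A \<subseteq> half_signs" and ob: "\<And>s t. s \<in> A \<Longrightarrow> t \<in> A \<Longrightarrow> s \<noteq> t \<Longrightarrow> s \<bullet> t \<le> - 1/2"
  shows "card A \<le> 4" and "card A = 4 \<Longrightarrow> \<Sum>A = 0"
proof -
  have fin: "finite A" using A finite_half_signs finite_subset by blast
  have "\<Sum>A \<bullet> \<Sum>A = (\<Sum>s\<in>A. \<Sum>t\<in>A. s \<bullet> t)"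
    by (simp add: inner_sum_left inner_sum_right inner_commute)
  \<comment> \<open>The summand is 3/2 on the diagonal and -1/2 off it.\<close>
  also have "\<dots> \<le> (\<Sum>s\<in>A. \<Sum>t\<in>A. (if t = s then 2 else 0) - 1/2)"
    using A ob half_signs_inner_self by (intro sum_mono) (fastforce simp: subset_iff)
  also have "\<dots> = real (card A) * (4 - real (card A)) / 2"
    by (simp add: sum_subtractf fin algebra_simps)
  finally have le: "\<Sum>A \<bullet> \<Sum>A \<le> real (card A) * (4 - real (card A)) / 2" .
  have "real (card A) * (4 - real (card A)) \<ge> 0"
    using le inner_ge_zero[of "\<Sum>A"] by linarith
  then show "card A \<le> 4" by (cases "card A = 0") (auto simp: zero_le_mult_iff)
  show "\<Sum>A = 0" if "card A = 4" using le that by simp (meson inner_gt_zero_iff not_less)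
qed

text \<open>The six coordinates are identified with the 2-subsets of a 4-clique: two equal columns would
  put two of the vectors at an acute angle, so the columns are the six balanced sign patterns.\<close>
lemma obtuse_four_columns:
  fixes A :: "(real^6) set"
  assumes A: "A \<subseteq> half_signs" and ob: "\<And>s t. s \<in> A \<Longrightarrow> t \<in> A \<Longrightarrow> s \<noteq> t \<Longrightarrow> s \<bullet> t \<le> - 1/2"
    and card: "card A = 4"
  obtains e1 e2 e3 e4 and i12 i13 i14 i23 i24 i34 :: 6 where "A = {e1, e2, e3, e4}"
    "UNIV = {i12, i13, i14, i23, i24, i34}" "distinct [i12, i13, i14, i23, i24, i34]"
    "e1 + e2 + e3 + e4 = 0"
    "e1 $ i12 = 1/2" "e1 $ i13 = 1/2" "e1 $ i14 = 1/2" "e1 $ i23 = -1/2" "e1 $ i24 = -1/2" "e1 $ i34 = -1/2"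
    "e2 $ i12 = 1/2" "e2 $ i13 = -1/2" "e2 $ i14 = -1/2" "e2 $ i23 = 1/2" "e2 $ i24 = 1/2" "e2 $ i34 = -1/2"
    "e3 $ i12 = -1/2" "e3 $ i13 = 1/2" "e3 $ i14 = -1/2" "e3 $ i23 = 1/2" "e3 $ i24 = -1/2" "e3 $ i34 = 1/2"
    "e4 $ i12 = -1/2" "e4 $ i13 = -1/2" "e4 $ i14 = 1/2" "e4 $ i23 = -1/2" "e4 $ i24 = 1/2" "e4 $ i34 = 1/2"
proof -
  from card obtain e1 e2 e3 e4 where Aeq: "A = {e1, e2, e3, e4}" and dist: "distinct [e1, e2, e3, e4]"
    by (auto simp: numeral_eq_Suc card_Suc_eq)
  have sum0: "e1 + e2 + e3 + e4 = 0"
    using obtuse_sum(2)[OF A ob card] dist unfolding Aeq by (simp add: add.assoc)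
  define c where "c = (\<lambda>i. (e1 $ i, e2 $ i, e3 $ i, e4 $ i))"
  define Bal :: "(real \<times> real \<times> real \<times> real) set" where
    "Bal = {(1/2,1/2,-1/2,-1/2), (1/2,-1/2,1/2,-1/2), (1/2,-1/2,-1/2,1/2),
       (-1/2,1/2,1/2,-1/2), (-1/2,1/2,-1/2,1/2), (-1/2,-1/2,1/2,1/2)}"
  have c_Bal: "c i \<in> Bal" for i
  proof -
    have "e1 $ i + e2 $ i + e3 $ i + e4 $ i = 0"
      using sum0 by (metis vector_add_component zero_index)
    moreover have "s $ i = 1/2 \<or> s $ i = -1/2" if "s \<in> A" for s
      using A that by (auto simp: half_signs_def)
    then have "e1 $ i = 1/2 \<or> e1 $ i = -1/2" "e2 $ i = 1/2 \<or> e2 $ i = -1/2"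
      "e3 $ i = 1/2 \<or> e3 $ i = -1/2" "e4 $ i = 1/2 \<or> e4 $ i = -1/2"
      unfolding Aeq by blast+
    ultimately show ?thesis unfolding c_def Bal_def by (elim disjE) simp_all
  qed
  have common: False if "s \<in> A" "t \<in> A" "s \<noteq> t" "i \<noteq> j"
    "s $ i = 1/2" "t $ i = 1/2" "s $ j = 1/2" "t $ j = 1/2" for s t i j
    using half_signs_inner_common[of s t i j] ob[of s t] A that by fastforce
  have "inj c"
  proof (rule injI, rule ccontr)
    fix i j assume eq: "c i = c j" and ij: "i \<noteq> j"
    have "e1 \<noteq> e2" "e1 \<noteq> e3" "e1 \<noteq> e4" "e2 \<noteq> e3" "e2 \<noteq> e4" "e3 \<noteq> e4" using dist by auto
    then show False
      using c_Bal[of i] eq ij common[of e1 e2 i j] common[of e1 e3 i j] common[of e1 e4 i j]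
        common[of e2 e3 i j] common[of e2 e4 i j] common[of e3 e4 i j]
      unfolding c_def Bal_def Aeq by auto
  qed
  moreover have cB: "card Bal = 6" unfolding Bal_def by simp
  ultimately have "card (range c) = card Bal" by (simp add: card_image)
  moreover have "finite Bal" unfolding Bal_def by simp
  moreover have "range c \<subseteq> Bal" using c_Bal by blast
  ultimately have rng: "range c = Bal" by (metis card_subset_eq)
  have ex: "\<exists>i. c i = b" if "b \<in> Bal" for b using rng that by (metis imageE)
  \<comment> \<open>The two digits of an index name the two vectors that are positive at that
    coordinate.\<close>
  obtain i12 i13 i14 i23 i24 i34 where i:
    "c i12 = (1/2,1/2,-1/2,-1/2)" "c i13 = (1/2,-1/2,1/2,-1/2)" "c i14 = (1/2,-1/2,-1/2,1/2)"
    "c i23 = (-1/2,1/2,1/2,-1/2)" "c i24 = (-1/2,1/2,-1/2,1/2)" "c i34 = (-1/2,-1/2,1/2,1/2)"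
    using ex unfolding Bal_def by (metis insertCI)
  have d: "distinct [i12, i13, i14, i23, i24, i34]" using i by auto
  then have "card (set [i12, i13, i14, i23, i24, i34]) = card (UNIV :: 6 set)"
    by (subst distinct_card) auto
  then have U: "UNIV = {i12, i13, i14, i23, i24, i34}"
    by (metis card_subset_eq finite subset_UNIV list.simps(15) empty_set)
  show thesis
    by (rule that[OF Aeq U d sum0]) (use i in \<open>auto simp: c_def\<close>)
qed

section \<open>Sign vectors on the edges of the complete graph on four vertices\<close>

lemma sum_UNIV_distinct6:
  fixes g :: "6 \<Rightarrow> real"
  assumes "UNIV = {a, b, c, d, e, f}" "distinct [a, b, c, d, e, f]"
  shows "sum g UNIV = g a + g b + g c + g d + g e + g f"
  unfolding assms(1) using assms(2) by (simp add: add.assoc)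

text \<open>If the coordinates are the edges of the complete graph \<open>K\<^sub>4\<close>, ordered 12, 13, 14, 23, 24, 34, the
  clique consists of the four vertex stars. A sign vector at inner product \<open>\<plusminus>1/2\<close> with all stars is
  positive exactly on a Hamiltonian path.\<close>
definition path_lists :: "int list list" where
  "path_lists = filter (\<lambda>l. sum_list l = 0 \<and>
      list_all (\<lambda>I. \<bar>\<Sum>i\<leftarrow>I. l ! i\<bar> = 1) [[0,1,2],[0,3,4],[1,3,5],[2,4,5]])
    (product_lists (replicate 6 [1, -1]))"

text \<open>Lists hold doubled coordinates, so this is four times the real inner product: the bound
  -1/2 becomes -2.\<close>

definition list_inner :: "int list \<Rightarrow> int list \<Rightarrow> int" where
  "list_inner xs ys = sum_list (map2 (*) xs ys)"

text \<open>The four vertex stars, then their negatives, in doubled coordinates.\<close>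

definition star_lists :: "int list list" where
  "star_lists = [[1,1,1,-1,-1,-1],[1,-1,-1,1,1,-1],[-1,1,-1,1,-1,1],[-1,-1,1,-1,1,1],
     [-1,-1,-1,1,1,1],[-1,1,1,-1,-1,1],[1,-1,1,-1,1,-1],[1,1,-1,1,-1,-1]]"

text \<open>Such a sum of three vectors has squared norm at most 9/2 - 3 = 3/2 and odd multiples of
  1/2 as entries, so it is again a sign vector. That it is a star up to sign is checked by
  evaluation over the twelve Hamiltonian paths. Equal lists have product 6, so the filters also
  enforce distinctness.\<close>

lemma path_lists_triples:
  "list_all (\<lambda>xs. let Y = filter (\<lambda>ys. list_inner xs ys \<le> -2) path_lists in
     list_all (\<lambda>ys. list_all (\<lambda>zs. map2 (+) (map2 (+) xs ys) zs \<in> set star_lists)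
       (filter (\<lambda>zs. list_inner ys zs \<le> -2) Y)) Y) path_lists"
  by code_simp

text \<open>The set \<open>A\<close> labels the coordinates by edges; the members of
  \<open>B\<close> then become lists to which the evaluated statement applies.\<close>

lemma obtuse_triple_sum:
  fixes A B :: "(real^6) set"
  assumes A: "A \<subseteq> half_signs" and obA: "\<And>s t. s \<in> A \<Longrightarrow> t \<in> A \<Longrightarrow> s \<noteq> t \<Longrightarrow> s \<bullet> t \<le> - 1/2"
    and card: "card A = 4"
    and B: "B \<subseteq> half_signs" and obB: "\<And>s t. s \<in> B \<Longrightarrow> t \<in> B \<Longrightarrow> s \<noteq> t \<Longrightarrow> s \<bullet> t \<le> - 1/2"
    and AB: "\<And>s t. s \<in> A \<Longrightarrow> t \<in> B \<Longrightarrow> \<bar>s \<bullet> t\<bar> = 1/2"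
    and fgh: "f \<in> B" "g \<in> B" "h \<in> B" "f \<noteq> g" "f \<noteq> h" "g \<noteq> h"
  obtains a where "a \<in> A" "f + g + h = a \<or> f + g + h = - a"
proof -
  obtain e1 e2 e3 e4 and i12 i13 i14 i23 i24 i34 :: 6 where Aeq: "A = {e1, e2, e3, e4}"
    and U: "UNIV = {i12, i13, i14, i23, i24, i34}" and d: "distinct [i12, i13, i14, i23, i24, i34]"
    and e0: "e1 + e2 + e3 + e4 = 0" and vals:
    "e1 $ i12 = 1/2" "e1 $ i13 = 1/2" "e1 $ i14 = 1/2" "e1 $ i23 = -1/2" "e1 $ i24 = -1/2" "e1 $ i34 = -1/2"
    "e2 $ i12 = 1/2" "e2 $ i13 = -1/2" "e2 $ i14 = -1/2" "e2 $ i23 = 1/2" "e2 $ i24 = 1/2" "e2 $ i34 = -1/2"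
    "e3 $ i12 = -1/2" "e3 $ i13 = 1/2" "e3 $ i14 = -1/2" "e3 $ i23 = 1/2" "e3 $ i24 = -1/2" "e3 $ i34 = 1/2"
    "e4 $ i12 = -1/2" "e4 $ i13 = -1/2" "e4 $ i14 = 1/2" "e4 $ i23 = -1/2" "e4 $ i24 = 1/2" "e4 $ i34 = 1/2"
    by (rule obtuse_four_columns[OF A obA card])
  note sumU = sum_UNIV_distinct6[OF U d]
  define sg :: "real^6 \<Rightarrow> 6 \<Rightarrow> int" where "sg = (\<lambda>s i. if s $ i = 1/2 then 1 else -1)"
  have sg: "s $ i = of_int (sg s i) / 2" if "s \<in> B" for s i
  proof -
    have "s $ i = 1/2 \<or> s $ i = -1/2" using B that by (auto simp: half_signs_def)
    then show ?thesis by (auto simp: sg_def)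
  qed
  define l where "l = (\<lambda>s. map (sg s) [i12, i13, i14, i23, i24, i34])"
  have path: "l s \<in> set path_lists" if s: "s \<in> B" for s
  proof -
    have "sum (($) s) UNIV = 0" using B s by (auto simp: half_signs_def)
    then have 0: "sg s i12 + sg s i13 + sg s i14 + sg s i23 + sg s i24 + sg s i34 = 0"
      unfolding sumU sg[OF s] by linarith
    have "\<bar>e1 \<bullet> s\<bar> = 1/2" "\<bar>e2 \<bullet> s\<bar> = 1/2" "\<bar>e3 \<bullet> s\<bar> = 1/2" "\<bar>e4 \<bullet> s\<bar> = 1/2"
      using AB s by (auto simp: Aeq)
    \<comment> \<open>The coordinates of \<open>s\<close> sum to 0, so its inner product with a star
      is its sum over the three edges of that star.\<close>
    then have "\<bar>sg s i12 + sg s i13 + sg s i14\<bar> = 1" "\<bar>sg s i12 + sg s i23 + sg s i24\<bar> = 1"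
      "\<bar>sg s i13 + sg s i23 + sg s i34\<bar> = 1" "\<bar>sg s i14 + sg s i24 + sg s i34\<bar> = 1"
      using 0 unfolding inner_vec_def sumU vals sg[OF s] inner_real_def by linarith+
    then have "sum_list (l s) = 0 \<and>
        list_all (\<lambda>I. \<bar>\<Sum>i\<leftarrow>I. l s ! i\<bar> = 1) [[0,1,2],[0,3,4],[1,3,5],[2,4,5]]"
      using 0 by (simp add: l_def numeral_eq_Suc add.assoc)
    moreover have "l s \<in> set (product_lists (replicate 6 [1, -1]))"
      by (auto simp: product_lists_set l_def sg_def numeral_eq_Suc)
    ultimately show ?thesis unfolding path_lists_def set_filter mem_Collect_eq by (rule conjI[rotated])
  qed
  have inner: "list_inner (l s) (l t) \<le> -2" if "s \<in> B" "t \<in> B" "s \<noteq> t" for s t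
  proof -
    have "4 * (s \<bullet> t) = of_int (list_inner (l s) (l t))"
      unfolding inner_vec_def sumU sg[OF that(1)] sg[OF that(2)] inner_real_def list_inner_def l_def
      by simp
    then show ?thesis using obB[OF that] by linarith
  qed
  have mem: "map2 (+) (map2 (+) (l f) (l g)) (l h) \<in> set star_lists"
    using path_lists_triples path[OF fgh(1)] path[OF fgh(2)] path[OF fgh(3)]
      inner[of f g] inner[of f h] inner[of g h] fgh
    unfolding list_all_iff Let_def set_filter by blast
  have all: "(\<forall>i. P i) \<longleftrightarrow> P i12 \<and> P i13 \<and> P i14 \<and> P i23 \<and> P i24 \<and> P i34" for P
    using U by (metis UNIV_I empty_iff insert_iff)
  define t where "t = (\<lambda>i. sg f i + sg g i + sg h i)"
  have c: "(f + g + h) $ i = of_int (t i) / 2" for i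
    using sg[OF fgh(1)] sg[OF fgh(2)] sg[OF fgh(3)] by (simp add: t_def)
  have "map t [i12, i13, i14, i23, i24, i34] \<in> set star_lists"
    using mem by (simp add: l_def t_def)
  then have "f + g + h = e1 \<or> f + g + h = - e1 \<or> f + g + h = e2 \<or> f + g + h = - e2 \<or>
      f + g + h = e3 \<or> f + g + h = - e3 \<or> f + g + h = e4 \<or> f + g + h = - e4"
    unfolding star_lists_def list.set list.map insert_iff empty_iff list.inject
    by (elim disjE conjE) (simp_all add: vec_eq_iff c all vals del: vector_add_component)
  then show thesis using that by (auto simp: Aeq)
qed

text \<open>Four vectors of \<open>B\<close> would sum to 0, so the fourth would be minus the sum of
  the other three, hence some \<open>a\<close> in \<open>A\<close> up to sign. Then
  \<open>\<bar>a \<bullet> k\<bar>\<close> would be 3/2 instead of 1/2.\<close>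

lemma four_three_obtuse:
  fixes A B :: "(real^6) set"
  assumes A: "A \<subseteq> half_signs" and obA: "\<And>s t. s \<in> A \<Longrightarrow> t \<in> A \<Longrightarrow> s \<noteq> t \<Longrightarrow> s \<bullet> t \<le> - 1/2"
    and card: "card A = 4"
    and B: "B \<subseteq> half_signs" and obB: "\<And>s t. s \<in> B \<Longrightarrow> t \<in> B \<Longrightarrow> s \<noteq> t \<Longrightarrow> s \<bullet> t \<le> - 1/2"
    and AB: "\<And>s t. s \<in> A \<Longrightarrow> t \<in> B \<Longrightarrow> \<bar>s \<bullet> t\<bar> = 1/2"
  shows "card B \<le> 3" and "card B = 3 \<Longrightarrow> \<exists>a\<in>A. \<Sum>B = a \<or> \<Sum>B = - a"
proof -
  have triple: "\<exists>a\<in>A. f + g + h = a \<or> f + g + h = - a"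
    if "f \<in> B" "g \<in> B" "h \<in> B" "f \<noteq> g" "f \<noteq> h" "g \<noteq> h" for f g h
    by (rule obtuse_triple_sum[OF A obA card B obB AB that]) auto
  show "\<exists>a\<in>A. \<Sum>B = a \<or> \<Sum>B = - a" if "card B = 3"
  proof -
    from that obtain f g h where Beq: "B = {f, g, h}" and dist: "f \<noteq> g" "f \<noteq> h" "g \<noteq> h"
      by (auto simp: numeral_eq_Suc card_Suc_eq)
    have "\<Sum>B = f + g + h" using dist by (simp add: Beq add.assoc)
    moreover have "\<exists>a\<in>A. f + g + h = a \<or> f + g + h = - a"
      by (rule triple) (use dist in \<open>auto simp: Beq\<close>)
    ultimately show ?thesis by metis
  qed
  show "card B \<le> 3"
  proof (rule ccontr)
    assume "\<not> card B \<le> 3"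
    then have "card B = 4" using obtuse_sum(1)[OF B obB] by simp
    then obtain f g h k where Beq: "B = {f, g, h, k}" and dist: "distinct [f, g, h, k]"
      by (auto simp: numeral_eq_Suc card_Suc_eq)
    obtain a where a: "a \<in> A" "f + g + h = a \<or> f + g + h = - a"
      using triple[of f g h] dist by (auto simp: Beq)
    have "f + g + h + k = 0"
      using obtuse_sum(2)[OF B obB \<open>card B = 4\<close>] dist by (simp add: Beq add.assoc)
    then have "k = - (f + g + h)" by (metis add.commute eq_neg_iff_add_eq_0)
    with a(2) have "k = a \<or> k = - a" by (metis minus_minus)
    then show False
      using AB[OF a(1), of k] half_signs_inner_self[of a] A a(1) by (auto simp: Beq)
  qed
qed

text \<open>The key relation is \<open>\<Sum>B = \<plusminus>a\<close> with \<open>a \<in> A\<close>: it bounds \<open>T'\<close> by \<open>|r \<bullet> a|\<close>, which is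
  small when \<open>|T|\<close> is large because \<open>\<Sum>A = 0\<close>.\<close>
lemma four_three_bound:
  fixes A B :: "(real^6) set" and r :: "real^6" and T T' :: real
  assumes A: "A \<subseteq> half_signs" and obA: "\<And>s t. s \<in> A \<Longrightarrow> t \<in> A \<Longrightarrow> s \<noteq> t \<Longrightarrow> s \<bullet> t \<le> - 1/2"
    and cA: "card A = 4"
    and B: "B \<subseteq> half_signs" and obB: "\<And>s t. s \<in> B \<Longrightarrow> t \<in> B \<Longrightarrow> s \<noteq> t \<Longrightarrow> s \<bullet> t \<le> - 1/2"
    and AB: "\<And>s t. s \<in> A \<Longrightarrow> t \<in> B \<Longrightarrow> \<bar>s \<bullet> t\<bar> = 1/2"
    and cB: "card B = 3"
    and rA: "\<And>s. s \<in> A \<Longrightarrow> \<bar>r \<bullet> s + T / 2\<bar> = 1/2"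
    and rB: "\<And>s. s \<in> B \<Longrightarrow> \<bar>r \<bullet> s + T' / 2\<bar> = 1/2"
  shows "T\<^sup>2 + T'\<^sup>2 < 8/3"
proof -
  obtain a where a: "a \<in> A" "\<Sum>B = a \<or> \<Sum>B = - a"
    using four_three_obtuse(2)[OF A obA cA B obB AB cB] by blast
  have "card (A - {a}) = 3" using a(1) cA by simp
  then obtain b c d where "A - {a} = {b, c, d}" and dist: "b \<noteq> c" "b \<noteq> d" "c \<noteq> d"
    by (auto simp: numeral_eq_Suc card_Suc_eq)
  then have Aeq: "A = {a, b, c, d}" and dist': "a \<noteq> b" "a \<noteq> c" "a \<noteq> d" using a(1) by auto
  have "a + b + c + d = 0"
    using obtuse_sum(2)[OF A obA cA] dist dist' by (simp add: Aeq add.assoc)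
  then have sA: "r \<bullet> a + r \<bullet> b + r \<bullet> c + r \<bullet> d = 0"
    by (metis inner_add_right inner_zero_right)
  obtain f g h where Beq: "B = {f, g, h}" and distB: "f \<noteq> g" "f \<noteq> h" "g \<noteq> h"
    using cB by (auto simp: numeral_eq_Suc card_Suc_eq)
  have "\<Sum>B = f + g + h" using distB by (simp add: Beq add.assoc)
  then have sB: "\<bar>r \<bullet> f + r \<bullet> g + r \<bullet> h\<bar> = \<bar>r \<bullet> a\<bar>"
    using a(2) by (metis abs_minus_cancel inner_add_right inner_minus_right)
  have abcd: "\<bar>r \<bullet> a + T / 2\<bar> = 1/2" "\<bar>r \<bullet> b + T / 2\<bar> = 1/2" "\<bar>r \<bullet> c + T / 2\<bar> = 1/2" "\<bar>r \<bullet> d + T / 2\<bar> = 1/2"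
    using rA by (auto simp: Aeq)
  have fgh: "\<bar>r \<bullet> f + T' / 2\<bar> = 1/2" "\<bar>r \<bullet> g + T' / 2\<bar> = 1/2" "\<bar>r \<bullet> h + T' / 2\<bar> = 1/2"
    using rB by (auto simp: Beq)
  \<comment> \<open>Each of the three inner products with \<open>r\<close> is within 1/2 of
    \<open>- T' / 2\<close>; add the three estimates.\<close>
  have T': "\<bar>T'\<bar> \<le> 1 + 2/3 * \<bar>r \<bullet> a\<bar>" using sB fgh by linarith
  \<comment> \<open>The four numbers \<open>r \<bullet> s + T / 2\<close> are 1/2 up to sign and add
    up to \<open>2 * T\<close>, so \<open>T\<close> is 0, 1/2 or 1 up to sign. In the last case all
    four signs agree and \<open>r \<bullet> a = 0\<close>.\<close>
  have "(\<bar>T\<bar> \<le> 1 \<and> r \<bullet> a = 0) \<or> (T = 0 \<and> \<bar>r \<bullet> a\<bar> = 1/2) \<or> (\<bar>T\<bar> = 1/2 \<and> \<bar>r \<bullet> a\<bar> \<le> 3/4)"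
    using abcd sA by (auto simp: abs_if split: if_splits)
  then have "(\<bar>T\<bar> \<le> 1 \<and> \<bar>T'\<bar> \<le> 1) \<or> (\<bar>T\<bar> \<le> 0 \<and> \<bar>T'\<bar> \<le> 4/3) \<or> (\<bar>T\<bar> \<le> 1/2 \<and> \<bar>T'\<bar> \<le> 3/2)"
    using T' by auto
  moreover have "T\<^sup>2 + T'\<^sup>2 \<le> x\<^sup>2 + y\<^sup>2" if "\<bar>T\<bar> \<le> x \<and> \<bar>T'\<bar> \<le> y" for x y
    using that by (intro add_mono) (auto simp: abs_le_square_iff[symmetric])
  \<comment> \<open>The three cases give at most 2, 16/9 and 5/2, all below 8/3.\<close>
  ultimately show ?thesis by (fastforce simp: power2_eq_square)
qed

section \<open>The two combinatorial parts\<close>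

text \<open>The last block adds 1/2 to every inner product of the full vectors; subtracting it turns
  the allowed values 0 and 1 into -1/2 and 1/2.\<close>

definition glue_config :: "((real^6) \<times> real \<times> real) set \<Rightarrow> bool" where
  "glue_config W \<longleftrightarrow> W \<subseteq> half_signs \<times> {1, -1} \<times> {1, -1} \<and>
     (\<forall>(s, a, b)\<in>W. \<forall>(s', a', b')\<in>W. (s, a, b) \<noteq> (s', a', b') \<longrightarrow>
        \<bar>s \<bullet> s' + (a * a' + b * b') / 2\<bar> = 1/2)"

text \<open>Multiplying by \<open>a\<close> normalises the first sign to 1; only the product \<open>a * b\<close> then matters.\<close>
definition glue_class :: "((real^6) \<times> real \<times> real) set \<Rightarrow> real \<Rightarrow> (real^6) set" where
  "glue_class W \<delta> = (\<lambda>(s, a, b). a *\<^sub>R s) ` {(s, a, b). (s, a, b) \<in> W \<and> a * b = \<delta>}"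

section \<open>The two classes of a glue configuration\<close>

lemma half_signs_scale: "s \<in> half_signs \<Longrightarrow> a = 1 \<or> a = -1 \<Longrightarrow> a *\<^sub>R s \<in> half_signs"
  by (auto simp: half_signs_def sum_negf)

context
  fixes W assumes W: "glue_config W"
begin

lemma glue_config_memD:
  assumes "(s, a, b) \<in> W"
  shows "s \<in> half_signs" "a = 1 \<or> a = -1" "b = 1 \<or> b = -1"
  using W assms unfolding glue_config_def by auto

lemma glue_config_inner:
  assumes "(s, a, b) \<in> W" "(s', a', b') \<in> W" "(s, a, b) \<noteq> (s', a', b')"
  shows "\<bar>s \<bullet> s' + (a * a' + b * b') / 2\<bar> = 1/2"
  using W assms unfolding glue_config_def by fast

lemma finite_glue_config: "finite W"
  using W finite_half_signs unfolding glue_config_def by (meson finite.intros finite_SigmaI finite_subset)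

text \<open>Multiply the expression inside the absolute value by \<open>a * a'\<close>, which is 1
  or -1.\<close>

lemma glue_config_scaled_inner:
  assumes m: "(s, a, b) \<in> W" "(s', a', b') \<in> W" and ne: "(s, a, b) \<noteq> (s', a', b')"
  shows "\<bar>(a *\<^sub>R s) \<bullet> (a' *\<^sub>R s') + (1 + (a * b) * (a' * b')) / 2\<bar> = 1/2"
  using glue_config_inner[OF m ne] glue_config_memD[OF m(1)] glue_config_memD[OF m(2)]
  by (elim disjE) (simp_all add: abs_if split: if_splits)

lemma glue_class_half_signs: "glue_class W \<delta> \<subseteq> half_signs"
  unfolding glue_class_def using glue_config_memD half_signs_scale by fastforce

text \<open>Inside a class the constant term is 1, which leaves only the values -1/2 and -3/2.
  Stating this for members of \<open>W\<close>, not for their images, makes it usable for the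
  injectivity of the normalisation as well.\<close>

lemma glue_class_scaled_inner_le:
  assumes m: "(s, a, b) \<in> W" "(s', a', b') \<in> W" and ne: "(s, a, b) \<noteq> (s', a', b')"
    and eq: "a * b = a' * b'"
  shows "(a *\<^sub>R s) \<bullet> (a' *\<^sub>R s') \<le> - 1/2"
proof -
  have "a' * b' = 1 \<or> a' * b' = -1" using glue_config_memD[OF m(2)] by auto
  then have "(a * b) * (a' * b') = 1" unfolding eq by auto
  moreover have "x \<le> - 1/2" if "\<bar>x + (1 + 1) / 2\<bar> = 1/2" for x :: real
    using that by (simp add: abs_if split: if_splits)
  ultimately show ?thesis using glue_config_scaled_inner[OF m ne] by metis
qed

lemma glue_class_obtuse:
  assumes "s \<in> glue_class W \<delta>" "t \<in> glue_class W \<delta>" "s \<noteq> t"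
  shows "s \<bullet> t \<le> - 1/2"
  using assms glue_class_scaled_inner_le unfolding glue_class_def by fastforce

text \<open>Between the two classes the constant term cancels.\<close>

lemma glue_class_cross:
  assumes "s \<in> glue_class W \<delta>" "t \<in> glue_class W (- \<delta>)" and \<delta>: "\<delta> = 1 \<or> \<delta> = -1"
  shows "\<bar>s \<bullet> t\<bar> = 1/2"
proof -
  from assms obtain s0 a b t0 a' b' where m: "(s0, a, b) \<in> W" "(t0, a', b') \<in> W"
    and st: "s = a *\<^sub>R s0" "t = a' *\<^sub>R t0" and ab: "a * b = \<delta>" "a' * b' = - \<delta>"
    unfolding glue_class_def by auto
  have "(s0, a, b) \<noteq> (t0, a', b')" "\<delta> * - \<delta> = -1" using ab \<delta> by auto
  then show ?thesis using glue_config_scaled_inner[OF m] unfolding ab st by auto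
qed

lemma card_glue_config: "card W = card (glue_class W 1) + card (glue_class W (-1))"
proof -
  define V where "V = (\<lambda>\<delta>. {(s, a, b). (s, a, b) \<in> W \<and> a * b = \<delta>})"
  have c: "card (glue_class W \<delta>) = card (V \<delta>)" for \<delta>
  proof -
    have "inj_on (\<lambda>(s, a, b). a *\<^sub>R s) (V \<delta>)"
    proof (rule inj_onI)
      fix x y assume xy: "x \<in> V \<delta>" "y \<in> V \<delta>"
        and "(case x of (s, a, b) \<Rightarrow> a *\<^sub>R s) = (case y of (s, a, b) \<Rightarrow> a *\<^sub>R s)"
      moreover obtain s a b s' a' b' where x: "x = (s, a, b)" and y: "y = (s', a', b')"
        by (cases x, cases y)
      ultimately have m: "(s, a, b) \<in> V \<delta>" "(s', a', b') \<in> V \<delta>" and eq: "a *\<^sub>R s = a' *\<^sub>R s'"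
        by auto
      show "x = y"
      \<comment> \<open>Two members with the same image would have a scaled inner product that is a
        squared norm, yet at most -1/2.\<close>
      proof (rule ccontr)
        assume "x \<noteq> y"
        then have "(s, a, b) \<noteq> (s', a', b')" by (simp add: x y)
        then have "(a *\<^sub>R s) \<bullet> (a' *\<^sub>R s') \<le> - 1/2"
          using m glue_class_scaled_inner_le[of s a b s' a' b'] by (simp add: V_def)
        then show False using eq inner_ge_zero[of "a *\<^sub>R s"] by simp
      qed
    qed
    then show ?thesis unfolding glue_class_def V_def by (rule card_image)
  qed
  have "W = V 1 \<union> V (-1)" unfolding V_def using glue_config_memD by fastforce
  moreover have "finite (V \<delta>)" for \<delta>
    by (rule finite_subset[OF _ finite_glue_config]) (auto simp: V_def)
  moreover have "V 1 \<inter> V (-1) = {}" unfolding V_def by auto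
  ultimately show ?thesis unfolding c by (metis card_Un_disjoint)
qed

lemma glue_classes_four_three:
  assumes \<delta>: "\<delta> = 1 \<or> \<delta> = -1" and card: "card (glue_class W \<delta>) = 4"
  shows "card (glue_class W (- \<delta>)) \<le> 3"
  by (rule four_three_obtuse(1)[OF glue_class_half_signs glue_class_obtuse card
        glue_class_half_signs glue_class_obtuse glue_class_cross[OF _ _ \<delta>]])

text \<open>Apply the four-three bound with \<open>T = t1 + \<delta> * t2\<close> and
  \<open>T' = t1 - \<delta> * t2\<close>; their squares add up to twice
  \<open>t1\<^sup>2 + t2\<^sup>2\<close>.\<close>

lemma glue_classes_bound:
  assumes \<delta>: "\<delta> = 1 \<or> \<delta> = -1"
    and card: "card (glue_class W \<delta>) = 4" "card (glue_class W (- \<delta>)) = 3"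
    and r: "\<And>s a b. (s, a, b) \<in> W \<Longrightarrow> \<bar>r \<bullet> s + (a * t1 + b * t2) / 2\<bar> = 1/2"
  shows "t1\<^sup>2 + t2\<^sup>2 < 4/3"
proof -
  have eq: "\<bar>r \<bullet> s + (t1 + \<epsilon> * t2) / 2\<bar> = 1/2" if "s \<in> glue_class W \<epsilon>" for s \<epsilon>
  proof -
    from that obtain s0 a b where m: "(s0, a, b) \<in> W" "s = a *\<^sub>R s0" "\<epsilon> = a * b"
      unfolding glue_class_def by auto
    have a: "a = 1 \<or> a = -1" using glue_config_memD[OF m(1)] by blast
    then have "r \<bullet> s + (t1 + \<epsilon> * t2) / 2 = a * (r \<bullet> s0 + (a * t1 + b * t2) / 2)"
      unfolding m(2,3) by (elim disjE) (simp_all add: field_simps)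
    then show ?thesis using r[OF m(1)] a by (auto simp: abs_mult)
  qed
  have "(t1 + \<delta> * t2)\<^sup>2 + (t1 + - \<delta> * t2)\<^sup>2 < 8/3"
    by (rule four_three_bound[OF glue_class_half_signs glue_class_obtuse card(1)
          glue_class_half_signs glue_class_obtuse glue_class_cross[OF _ _ \<delta>] card(2) eq eq])
  moreover have "\<delta>\<^sup>2 = 1" using \<delta> by auto
  ultimately show ?thesis by (simp add: power2_sum power2_diff power_mult_distrib)
qed

text \<open>Each class has at most four members, and a class of four limits the other one to
  three.\<close>

lemma glue_config_card_le: "card W \<le> 7"
  using card_glue_config glue_classes_four_three[of 1] glue_classes_four_three[of "-1"]
    obtuse_sum(1)[OF glue_class_half_signs glue_class_obtuse, of 1]
    obtuse_sum(1)[OF glue_class_half_signs glue_class_obtuse, of "-1"]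
  by fastforce

lemma glue_config_bound:
  assumes card: "card W = 7"
    and r: "\<And>s a b. (s, a, b) \<in> W \<Longrightarrow> \<bar>r \<bullet> s + (a * t1 + b * t2) / 2\<bar> = 1/2"
  shows "t1\<^sup>2 + t2\<^sup>2 < 4/3"
proof -
  have le: "card (glue_class W \<delta>) \<le> 4" for \<delta>
    by (rule obtuse_sum(1)[OF glue_class_half_signs glue_class_obtuse])
  have "card (glue_class W 1) + card (glue_class W (-1)) = 7"
    using card card_glue_config by simp
  then have "(card (glue_class W 1) = 4 \<and> card (glue_class W (-1)) = 3) \<or>
      (card (glue_class W (-1)) = 4 \<and> card (glue_class W 1) = 3)"
    using le[of 1] le[of "-1"] by linarith
  then show ?thesis using glue_classes_bound[of 1 r t1 t2] glue_classes_bound[of "-1" r t1 t2] r by auto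
qed

end

text \<open>Summing over an orthogonal array makes the mixed terms vanish.\<close>
lemma orthogonal_array_energy:
  fixes Z :: "(6 \<times> 6 \<times> 6) set" and p q r :: "real^6"
  assumes ij: "inj_on (\<lambda>(i, j, k). (i, j)) Z" and ik: "inj_on (\<lambda>(i, j, k). (i, k)) Z"
    and jk: "inj_on (\<lambda>(i, j, k). (j, k)) Z" and card: "card Z = 36"
    and sum: "(\<Sum>i\<in>UNIV. p $ i) = 0" "(\<Sum>i\<in>UNIV. q $ i) = 0" "(\<Sum>i\<in>UNIV. r $ i) = 0"
    and half: "\<And>i j k. (i, j, k) \<in> Z \<Longrightarrow> \<bar>p $ i + q $ j + r $ k\<bar> = 1/2"
  shows "p \<bullet> p + q \<bullet> q + r \<bullet> r = 3/2"
proof -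
  have bij: "bij_betw f Z UNIV" if "inj_on f Z" for f :: "6 \<times> 6 \<times> 6 \<Rightarrow> 6 \<times> 6"
  proof -
    have "card (f ` Z) = card (UNIV :: (6 \<times> 6) set)" using that card by (simp add: card_image)
    then have "f ` Z = UNIV" by (metis card_subset_eq finite subset_UNIV)
    then show ?thesis using that by (simp add: bij_betw_def)
  qed
  have re: "(\<Sum>z\<in>Z. g (f z)) = (\<Sum>x\<in>UNIV. \<Sum>y\<in>UNIV. g (x, y))" if "inj_on f Z"
    for f :: "6 \<times> 6 \<times> 6 \<Rightarrow> 6 \<times> 6" and g :: "6 \<times> 6 \<Rightarrow> real"
    using sum.reindex_bij_betw[OF bij[OF that], of g]
    by (simp add: sum.cartesian_product flip: UNIV_Times_UNIV)
  have zero: "(\<Sum>x\<in>UNIV. \<Sum>y\<in>UNIV. u $ x * v $ y) = 0" if "(\<Sum>i\<in>UNIV. v $ i) = 0" for u v :: "real^6"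
    using that by (simp flip: sum_distrib_left)
  have sq: "(\<Sum>x\<in>UNIV. \<Sum>y\<in>(UNIV :: 6 set). (u $ x)\<^sup>2) = 6 * (u \<bullet> u)" for u :: "real^6"
    by (simp add: inner_vec_def power2_eq_square flip: sum_distrib_left)
  have sq': "(\<Sum>x\<in>(UNIV :: 6 set). \<Sum>y\<in>UNIV. (u $ y)\<^sup>2) = 6 * (u \<bullet> u)" for u :: "real^6"
    by (simp add: inner_vec_def power2_eq_square)
  have "(\<Sum>(i, j, k)\<in>Z. (p $ i + q $ j + r $ k)\<^sup>2) = (\<Sum>z\<in>Z. (1/2)\<^sup>2)"
  proof (intro sum.cong refl, clarify)
    fix i j k assume "(i, j, k) \<in> Z"
    then show "(p $ i + q $ j + r $ k)\<^sup>2 = (1/2)\<^sup>2" using half by (metis power2_abs)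
  qed
  \<comment> \<open>There are 36 terms equal to 1/4.\<close>
  then have "9 = (\<Sum>(i, j, k)\<in>Z. (p $ i + q $ j + r $ k)\<^sup>2)"
    using card by (simp add: power2_eq_square)
  also have "\<dots> = (\<Sum>(i, j, k)\<in>Z. (p $ i)\<^sup>2) + (\<Sum>(i, j, k)\<in>Z. (q $ j)\<^sup>2) + (\<Sum>(i, j, k)\<in>Z. (r $ k)\<^sup>2)
      + 2 * (\<Sum>(i, j, k)\<in>Z. p $ i * q $ j) + 2 * (\<Sum>(i, j, k)\<in>Z. p $ i * r $ k)
      + 2 * (\<Sum>(i, j, k)\<in>Z. q $ j * r $ k)"
    unfolding sum.distrib[symmetric] sum_distrib_left
    by (intro sum.cong) (auto simp: power2_eq_square algebra_simps)
  \<comment> \<open>Each index occurs in six triples in each position, so the squares contribute six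
    times the three squared norms.\<close>
  finally show ?thesis
    using re[OF ij, of "\<lambda>(x, y). (p $ x)\<^sup>2"] re[OF ij, of "\<lambda>(x, y). (q $ y)\<^sup>2"]
      re[OF ik, of "\<lambda>(x, y). (r $ y)\<^sup>2"]
      re[OF ij, of "\<lambda>(x, y). p $ x * q $ y"] re[OF ik, of "\<lambda>(x, y). p $ x * r $ y"]
      re[OF jk, of "\<lambda>(x, y). q $ x * r $ y"] zero[OF sum(2), of p] zero[OF sum(3)] sq sq'
    by (simp add: case_prod_unfold)
qed

section \<open>Short vectors of the lattice\<close>

lemma int_span_subset:
  assumes "S \<subseteq> G" "0 \<in> G" and add: "\<And>x y. x \<in> G \<Longrightarrow> y \<in> G \<Longrightarrow> x + y \<in> G"
    and scale: "\<And>x c. x \<in> G \<Longrightarrow> of_int c *\<^sub>R x \<in> G"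
  shows "int_span S \<subseteq> G"
proof
  fix x assume "x \<in> int_span S"
  then obtain T c where T: "finite T" "T \<subseteq> S" and x: "x = (\<Sum>v\<in>T. of_int (c v) *\<^sub>R v)"
    unfolding int_span_def by auto
  show "x \<in> G" unfolding x using T
    by (induction T rule: finite_induct) (use assms in auto)
qed

lemma int_span_pair:
  assumes "x \<in> S" "y \<in> S"
  shows "x + y \<in> int_span S"
\<comment> \<open>Coefficients are attached to vectors, so \<open>x + x\<close> has to be a single
  term with coefficient 2.\<close>
proof (cases "x = y")
  case True
  then have "x + y = (\<Sum>v\<in>{x}. of_int 2 *\<^sub>R v)" by (simp add: scaleR_2)
  then show ?thesis unfolding int_span_def using assms
    by (intro CollectI exI[of _ "{x}"] exI[of _ "\<lambda>_. 2"]) auto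
next
  case False
  then have "x + y = (\<Sum>v\<in>{x, y}. of_int 1 *\<^sub>R v)" by simp
  then show ?thesis unfolding int_span_def using assms
    by (intro CollectI exI[of _ "{x, y}"] exI[of _ "\<lambda>_. 1"]) auto
qed

text \<open>The coordinate permutations of \<open>alpha5\<close>: the minimal vectors of their coset
  of \<open>A\<^sub>5\<close> in its dual lattice.\<close>

definition simplex_point :: "6 \<Rightarrow> real^6" where
  "simplex_point i = (\<chi> j. 1/6 - (if j = i then 1 else 0))"

lemma all_6: "(\<forall>i::6. P i) \<longleftrightarrow> P 0 \<and> P 1 \<and> P 2 \<and> P 3 \<and> P 4 \<and> P 5"
  by (metis UNIV_6 UNIV_I empty_iff insert_iff)

text \<open>The coordinate carrying \<open>-5/6\<close> in \<^const>\<open>alpha5\<close> is the sixth, and \<open>6 = 0\<close> in the index type.\<close>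
lemma alpha5_eq: "alpha5 = simplex_point 0"
  by (simp add: vec_eq_iff all_6 alpha5_def simplex_point_def vector_def)

lemma alpha1_nth [simp]: "alpha1 $ 1 = 1/2" "alpha1 $ 2 = -1/2"
  by (simp_all add: alpha1_def)

lemma alpha1_inner: "alpha1 \<bullet> alpha1 = 1/2"
  by (simp add: inner_vec_def sum_2)

lemma alpha1_nonzero: "alpha1 \<noteq> 0"
  using alpha1_inner by auto

text \<open>For \<open>w\<close> of coordinate sum 0 this reads off \<open>- w $ i\<close>.\<close>

lemma simplex_point_inner: "simplex_point i \<bullet> w = (\<Sum>j\<in>UNIV. w $ j) / 6 - w $ i"
proof -
  have "simplex_point i \<bullet> w = (\<Sum>j\<in>UNIV. w $ j / 6 - (if j = i then w $ j else 0))"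
    unfolding inner_vec_def simplex_point_def by (intro sum.cong) (auto simp: algebra_simps)
  then show ?thesis by (simp add: sum_subtractf sum_divide_distrib)
qed

lemma sum_simplex_point: "(\<Sum>j\<in>UNIV. simplex_point i $ j) = 0"
  by (simp add: simplex_point_def sum_subtractf)

text \<open>A coset of \<open>A\<^sub>5\<close> in its dual, which depends only on \<open>m\<close>
  modulo 6.\<close>

definition coset5 :: "int \<Rightarrow> (real^6) set" where
  "coset5 m = {w. (\<forall>i. w $ i - of_int m / 6 \<in> \<int>) \<and> (\<Sum>i\<in>UNIV. w $ i) = 0}"

text \<open>The dual of \<open>A\<^sub>1\<close> consists of the integer multiples of
  \<open>alpha1\<close>, and the parity of the multiple gives the coset.\<close>

definition coset1 :: "int \<Rightarrow> (real^2) set" where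
  "coset1 m = {of_int k *\<^sub>R alpha1 | k. even (k - m)}"

text \<open>The resulting index is a variable with an equation as premise, so the rule unifies with
  whatever arithmetic form the index has.\<close>

lemma coset5_add: "v \<in> coset5 m \<Longrightarrow> w \<in> coset5 n \<Longrightarrow> k = m + n \<Longrightarrow> v + w \<in> coset5 k"
  unfolding coset5_def
  by (auto simp: sum.distrib) (metis (no_types, opaque_lifting) Ints_add add_diff_add add_divide_distrib)

lemma coset5_scale: "v \<in> coset5 m \<Longrightarrow> k = c * m \<Longrightarrow> of_int c *\<^sub>R v \<in> coset5 k"
proof -
  assume v: "v \<in> coset5 m" and k: "k = c * m"
  have "of_int c * v $ i - of_int (c * m) / 6 = of_int c * (v $ i - of_int m / 6)" for i
    by (simp add: algebra_simps)
  then have "of_int c * v $ i - of_int (c * m) / 6 \<in> \<int>" for i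
    using v unfolding coset5_def by simp
  then show ?thesis using v unfolding coset5_def k by (simp flip: sum_distrib_left)
qed

lemma coset1_add: "v \<in> coset1 m \<Longrightarrow> w \<in> coset1 n \<Longrightarrow> j = m + n \<Longrightarrow> v + w \<in> coset1 j"
proof -
  assume j: "j = m + n"
  assume "v \<in> coset1 m" "w \<in> coset1 n"
  then obtain k l where "v = of_int k *\<^sub>R alpha1" "w = of_int l *\<^sub>R alpha1" "even (k - m)" "even (l - n)"
    unfolding coset1_def by auto
  then have "v + w = of_int (k + l) *\<^sub>R alpha1" "even (k + l - j)"
    by (auto simp: scaleR_add_left j)
  then show ?thesis unfolding coset1_def by blast
qed

lemma coset1_scale: "v \<in> coset1 m \<Longrightarrow> j = c * m \<Longrightarrow> of_int c *\<^sub>R v \<in> coset1 j"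
proof -
  assume j: "j = c * m"
  assume "v \<in> coset1 m"
  then obtain k where "v = of_int k *\<^sub>R alpha1" "even (k - m)" unfolding coset1_def by auto
  then have "of_int c *\<^sub>R v = of_int (c * k) *\<^sub>R alpha1" "even (c * k - j)"
    by (auto simp: j)
  then show ?thesis unfolding coset1_def by blast
qed

lemma root_lattice_A_coset5: "root_lattice_A = coset5 0"
  unfolding root_lattice_A_def coset5_def by simp

lemma root_lattice_A_coset1: "root_lattice_A = coset1 0"
proof (intro equalityI subsetI)
  fix x :: "real^2" assume "x \<in> root_lattice_A"
  then have "x $ 1 \<in> \<int>" and s: "x $ 1 + x $ 2 = 0" unfolding root_lattice_A_def by (auto simp: sum_2)
  then obtain k where "x $ 1 = of_int k" by (auto elim: Ints_cases)
  then have "x = of_int (2 * k) *\<^sub>R alpha1" using s by (simp add: vec_eq_iff forall_2)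
  then show "x \<in> coset1 0" unfolding coset1_def by fastforce
next
  fix x :: "real^2" assume "x \<in> coset1 0"
  then obtain k where "x = of_int k *\<^sub>R alpha1" "even k" unfolding coset1_def by auto
  moreover from this(2) obtain j where "k = 2 * j" by (auto elim: evenE)
  ultimately have "x = of_int (2 * j) *\<^sub>R alpha1" by simp
  then show "x \<in> root_lattice_A" unfolding root_lattice_A_def by (auto simp: sum_2 forall_2)
qed

section \<open>The cosets of \<Lambda> in \<open>L\<close>\<close>

lemma simplex_point_coset5: "simplex_point i \<in> coset5 1"
  unfolding coset5_def by (simp add: sum_simplex_point) (simp add: simplex_point_def)

lemma alpha1_coset1: "alpha1 \<in> coset1 1"
  unfolding coset1_def by (auto intro!: exI[of _ 1])

text \<open>The arguments are the coefficients of \<open>beta0\<close> to \<open>beta3\<close>; each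
  value is a coset of \<open>Lambda\<close>.\<close>

definition glued :: "int \<Rightarrow> int \<Rightarrow> int \<Rightarrow> int \<Rightarrow> R26 set" where
  "glued n0 n1 n2 n3 = coset5 (n0 + 3 * n1) \<times> coset5 (n0 + 3 * n2) \<times> coset5 (n0 + 3 * n3) \<times>
     coset1 (n2 + n3) \<times> coset1 (n1 + n3) \<times> coset1 (n1 + n2) \<times> coset1 (n0 + n1 + n2 + n3)"

lemma zero_coset: "0 \<in> coset5 0" "0 \<in> coset1 0"
  unfolding coset5_def coset1_def by auto

lemma L_glued:
  assumes "u \<in> L"
  obtains n0 n1 n2 n3 where "u \<in> glued n0 n1 n2 n3"
proof -
  define G where "G = {u. \<exists>n0 n1 n2 n3. u \<in> glued n0 n1 n2 n3}"
  have "L \<subseteq> G" unfolding L_def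
  proof (rule int_span_subset)
    have "Lambda = glued 0 0 0 0"
      unfolding Lambda_def glued_def root_lattice_A_coset5 root_lattice_A_coset1 by simp
    moreover have "beta0 \<in> glued 1 0 0 0" "beta1 \<in> glued 0 1 0 0" "beta2 \<in> glued 0 0 1 0" "beta3 \<in> glued 0 0 0 1"
      using simplex_point_coset5[of 0] coset5_scale[OF simplex_point_coset5[of 0], of 3 3] alpha1_coset1 zero_coset
      unfolding beta0_def beta1_def beta2_def beta3_def glued_def alpha5_eq by simp_all
    ultimately show "Lambda \<union> {beta0, beta1, beta2, beta3} \<subseteq> G" unfolding G_def by blast
    show "0 \<in> G" unfolding G_def glued_def using zero_coset
      by (auto simp: zero_prod_def intro!: exI[of _ 0])
  next
    fix x y assume "x \<in> G" "y \<in> G"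
    then obtain n0 n1 n2 n3 m0 m1 m2 m3 where "x \<in> glued n0 n1 n2 n3" "y \<in> glued m0 m1 m2 m3"
      unfolding G_def by auto
    then have "x + y \<in> glued (n0 + m0) (n1 + m1) (n2 + m2) (n3 + m3)"
      unfolding glued_def mem_Times_iff fst_add snd_add
      by (elim conjE, intro conjI) (rule coset5_add coset1_add, assumption, assumption, simp)+
    then show "x + y \<in> G" unfolding G_def by blast
  next
    fix x c assume "x \<in> G"
    then obtain n0 n1 n2 n3 where "x \<in> glued n0 n1 n2 n3"
      unfolding G_def by auto
    then have "of_int c *\<^sub>R x \<in> glued (c * n0) (c * n1) (c * n2) (c * n3)"
      unfolding glued_def mem_Times_iff fst_scaleR snd_scaleR
      by (elim conjE, intro conjI)
        (rule coset5_scale coset1_scale, assumption, simp add: algebra_simps)+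
    then show "of_int c *\<^sub>R x \<in> G" unfolding G_def by blast
  qed
  then show thesis using assms that unfolding G_def by blast
qed

lemma L_memI:
  assumes "b \<in> {beta0, beta1, beta2, beta3}" "u - b \<in> Lambda"
  shows "u \<in> L"
  using int_span_pair[of b "Lambda \<union> {beta0, beta1, beta2, beta3}" "u - b"] assms unfolding L_def by auto

text \<open>Write \<open>w $ i = r / 6 + z i\<close> with integers \<open>z i\<close> of sum
  \<open>- r\<close>. Then the squared norm is \<open>r * (6 - r) / 6\<close> plus the sum of the
  \<open>z i * (z i + 1)\<close>, which are nonnegative and vanish only at 0 and -1.\<close>

lemma coset5_norm:
  assumes w: "w \<in> coset5 m" and r: "r = of_int (m mod 6)"
  shows "w \<bullet> w \<ge> r * (6 - r) / 6"
    and "w \<bullet> w = r * (6 - r) / 6 \<Longrightarrow> w $ i = r / 6 \<or> w $ i = r / 6 - 1"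
proof -
  define z where "z = (\<lambda>i. \<lfloor>w $ i - r / 6\<rfloor>)"
  have "w $ i - r / 6 \<in> \<int>" for i
  proof -
    have "(of_int m :: real) = 6 * of_int (m div 6) + of_int (m mod 6)"
      by (metis mult_div_mod_eq of_int_add of_int_mult of_int_numeral)
    then have "of_int m / 6 = of_int (m div 6) + r / 6" unfolding r by (simp add: field_simps)
    then have "w $ i - r / 6 = (w $ i - of_int m / 6) + of_int (m div 6)" by linarith
    then show ?thesis using w unfolding coset5_def by (metis (mono_tags, lifting) Ints_add Ints_of_int mem_Collect_eq)
  qed
  then have "of_int (z i) = w $ i - r / 6" for i unfolding z_def by (metis Ints_cases floor_of_int)
  then have wz: "w $ i = r / 6 + of_int (z i)" for i by simp
  have "(\<Sum>i\<in>UNIV. w $ i) = 0" using w unfolding coset5_def by simp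
  then have sz: "(\<Sum>i\<in>UNIV. of_int (z i) :: real) = - r" unfolding wz by (simp add: sum.distrib)
  have nn: "of_int (z i) * (of_int (z i) + 1) \<ge> (0::real)" for i
  proof -
    have "z i * (z i + 1) \<ge> 0" by (cases "z i \<ge> 0") (auto simp: mult_nonneg_nonneg mult_nonpos_nonpos)
    then show ?thesis by (metis (mono_tags) of_int_0_le_iff of_int_1 of_int_add of_int_mult)
  qed
  have "w \<bullet> w = (\<Sum>i\<in>UNIV. r\<^sup>2 / 36 + (r / 3 - 1) * of_int (z i) + of_int (z i) * (of_int (z i) + 1))"
    unfolding inner_vec_def inner_real_def wz
    by (intro sum.cong) (auto simp: power2_eq_square field_simps)
  also have "\<dots> = r * (6 - r) / 6 + (\<Sum>i\<in>UNIV. of_int (z i) * (of_int (z i) + 1))"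
    unfolding sum.distrib sum_distrib_left[symmetric] sz by (simp add: power2_eq_square field_simps)
  finally have ww: "w \<bullet> w = r * (6 - r) / 6 + (\<Sum>i\<in>UNIV. of_int (z i) * (of_int (z i) + 1))" .
  then show "w \<bullet> w \<ge> r * (6 - r) / 6" using sum_nonneg[of UNIV, OF nn] by simp
  assume "w \<bullet> w = r * (6 - r) / 6"
  then have "(\<Sum>i\<in>UNIV. of_int (z i) * (of_int (z i) + 1)) = (0::real)" using ww by simp
  then have "of_int (z i) * (of_int (z i) + 1) = (0::real)"
    using nn by (simp add: sum_nonneg_eq_0_iff)
  then have "z i = 0 \<or> z i = -1" by (auto simp: add_eq_0_iff2)
  then show "w $ i = r / 6 \<or> w $ i = r / 6 - 1" using wz by auto
qed

text \<open>The coordinate sum is 1 minus the number of lowered entries, so exactly one entry is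
  lowered.\<close>

lemma simplex_point_characterization:
  assumes s: "(\<Sum>i\<in>UNIV. w $ i) = 0" and w: "\<And>i. w $ i = 1/6 \<or> w $ i = 1/6 - 1"
  shows "\<exists>i. w = simplex_point i"
proof -
  have "(\<Sum>i\<in>UNIV. w $ i) = (\<Sum>i\<in>UNIV. 1/6 - (if i \<in> {i. w $ i = 1/6 - 1} then 1 else 0))"
    using w by (intro sum.cong) (auto, (metis)?)
  then have "real (card {i. w $ i = 1/6 - 1}) = 1" using s by (simp add: sum_subtractf sum.If_cases)
  then obtain i where "{i. w $ i = 1/6 - 1} = {i}" by (auto simp: card_1_singleton_iff)
  then have "w = simplex_point i" using w unfolding simplex_point_def vec_eq_iff by auto
  then show ?thesis by blast
qed

text \<open>The last block is fixed because inner product 1 with \<rho> forces the coefficient of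
  \<open>alpha1\<close> there to be 1.\<close>

definition vec26 :: "real^6 \<Rightarrow> real^6 \<Rightarrow> real^6 \<Rightarrow> real \<Rightarrow> real \<Rightarrow> real \<Rightarrow> R26" where
  "vec26 p q r t1 t2 t3 = (p, q, r, t1 *\<^sub>R alpha1, t2 *\<^sub>R alpha1, t3 *\<^sub>R alpha1, alpha1)"

fun triple_vec :: "real \<Rightarrow> 6 \<times> 6 \<times> 6 \<Rightarrow> R26" where
  "triple_vec \<sigma> (i, j, k) =
     vec26 (\<sigma> *\<^sub>R simplex_point i) (\<sigma> *\<^sub>R simplex_point j) (\<sigma> *\<^sub>R simplex_point k) 0 0 0"

fun glue_vec1 glue_vec2 glue_vec3 :: "(real^6) \<times> real \<times> real \<Rightarrow> R26" where
  "glue_vec1 (s, a, b) = vec26 s 0 0 0 a b"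
| "glue_vec2 (s, a, b) = vec26 0 s 0 a 0 b"
| "glue_vec3 (s, a, b) = vec26 0 0 s a b 0"

section \<open>Inner products in coordinates\<close>

lemma vec26_inner:
  "vec26 p q r t1 t2 t3 \<bullet> vec26 p' q' r' t1' t2' t3' =
     p \<bullet> p' + q \<bullet> q' + r \<bullet> r' + (t1 * t1' + t2 * t2' + t3 * t3' + 1) / 2"
  by (simp add: vec26_def alpha1_inner field_simps)

lemma vec26_eq_iff:
  "vec26 p q r t1 t2 t3 = vec26 p' q' r' t1' t2' t3' \<longleftrightarrow>
     p = p' \<and> q = q' \<and> r = r' \<and> t1 = t1' \<and> t2 = t2' \<and> t3 = t3'"
  by (auto simp: vec26_def alpha1_nonzero)

lemma vec26_rho: "vec26 p q r t1 t2 t3 \<bullet> rho = 1"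
  by (simp add: vec26_def rho_def alpha1_inner)

lemma vec26_triple_inner:
  assumes "(\<Sum>i\<in>UNIV. p $ i) = 0" "(\<Sum>i\<in>UNIV. q $ i) = 0" "(\<Sum>i\<in>UNIV. r $ i) = 0"
  shows "vec26 p q r t1 t2 t3 \<bullet> triple_vec \<sigma> (i, j, k) = 1/2 - \<sigma> * (p $ i + q $ j + r $ k)"
  using assms simplex_point_inner[of i p] simplex_point_inner[of j q] simplex_point_inner[of k r]
  by (simp add: vec26_inner inner_commute algebra_simps)

text \<open>Two simplex points have inner product 5/6 if equal and -1/6 otherwise; the last block
  adds 1/2.\<close>

lemma triple_vec_inner:
  "triple_vec \<sigma> (i, j, k) \<bullet> triple_vec \<tau> (i', j', k') =
     \<sigma> * \<tau> * (of_bool (i = i') + of_bool (j = j') + of_bool (k = k') - 1/2) + 1/2"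
  using simplex_point_inner[of i "simplex_point i'"] simplex_point_inner[of j "simplex_point j'"]
    simplex_point_inner[of k "simplex_point k'"]
  by (simp add: vec26_inner sum_simplex_point) (simp add: simplex_point_def algebra_simps)

text \<open>Only \<open>n0\<close> modulo 6 and the parities of the other coefficients matter, which
  leaves a finite check. The parity hypothesis is what a last block equal to \<open>alpha1\<close>
  imposes.\<close>

lemma glue_residues:
  fixes n0 n1 n2 n3 :: int
  assumes "odd (n0 + n1 + n2 + n3)"
  shows "((n0 + 3 * n1) mod 6, (n0 + 3 * n2) mod 6, (n0 + 3 * n3) mod 6) \<in>
     {(1,1,1), (5,5,5), (3,0,0), (0,3,0), (0,0,3),
      (3,3,3), (1,4,4), (4,1,4), (4,4,1), (5,2,2), (2,5,2), (2,2,5)}"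
proof -
  define a where "a = n0 div 6"
  define b where "b = (\<lambda>n::int. n div 2)"
  define x where "x = n0 mod 6"
  define e where "e = (\<lambda>n::int. n mod 2)"
  have n0: "n0 = 6 * a + x" and n: "n = 2 * b n + e n" for n
    unfolding a_def x_def b_def e_def by simp_all
  have m: "(n0 + 3 * n) mod 6 = (x + 3 * e n) mod 6" for n
  proof -
    have "n0 + 3 * n = (x + 3 * e n) + 6 * (a + b n)" using n[of n] n0 by simp
    then show ?thesis by (metis mod_mult_self2)
  qed
  have "x \<in> {0, 1, 2, 3, 4, 5}" unfolding x_def by auto
  moreover have e: "e n = 0 \<or> e n = 1" for n unfolding e_def by presburger
  moreover have "odd (x + e n1 + e n2 + e n3)" using assms unfolding x_def e_def by presburger
  ultimately show ?thesis using e[of n1] e[of n2] e[of n3] unfolding m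
    by (elim insertE disjE emptyE; simp)
qed

lemma coset1_norm:
  assumes "w \<in> coset1 m"
  obtains k :: int where "w = of_int k *\<^sub>R alpha1" "even (k - m)" "w \<bullet> w = (of_int k)\<^sup>2 / 2"
  using assms unfolding coset1_def by (auto simp: alpha1_inner power2_eq_square)

lemma odd_square_ge: "odd (k::int) \<Longrightarrow> (of_int k :: real)\<^sup>2 \<ge> 1"
proof -
  assume "odd k"
  then have "\<bar>k\<bar> \<ge> 1" by (cases "k = 0") auto
  then have "(of_int \<bar>k\<bar> :: real) \<ge> 1" by linarith
  then show ?thesis by (metis abs_square_le_1 of_int_abs one_le_power power2_abs)
qed

text \<open>Lower bounds that already add up to the total are all attained.\<close>

lemma sum_tight:
  fixes P Q R A B C :: real
  assumes "p \<le> P" "q \<le> Q" "r \<le> R" "a \<le> A" "b \<le> B" "c \<le> C"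
    and "P + Q + R + (A + B + C) / 2 = p + q + r + (a + b + c) / 2"
  shows "P = p" "Q = q" "R = r" "A = a" "B = b" "C = c"
  using assms by (simp_all add: add_divide_distrib)

text \<open>The first six blocks share squared norm 5/2. For each residue triple of the
  \<open>A\<^sub>5\<close> blocks the minimal norms either exceed 5/2 or, with the odd
  \<open>A\<^sub>1\<close> coefficients, add up to exactly 5/2, which makes every block
  minimal.\<close>

lemma short_vector_cases:
  assumes u: "u \<in> L" and rho: "u \<bullet> rho = 1" and norm: "u \<bullet> u = 3"
  obtains \<sigma> z where "\<sigma> = 1 \<or> \<sigma> = -1" "u = triple_vec \<sigma> z"
  | w where "w \<in> half_signs \<times> {1, -1} \<times> {1, -1}" "u = glue_vec1 w"
  | w where "w \<in> half_signs \<times> {1, -1} \<times> {1, -1}" "u = glue_vec2 w"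
  | w where "w \<in> half_signs \<times> {1, -1} \<times> {1, -1}" "u = glue_vec3 w"
proof -
  obtain n0 n1 n2 n3 where "u \<in> glued n0 n1 n2 n3" using L_glued[OF u] .
  then obtain p q r u4 u5 u6 u7 where ueq: "u = (p, q, r, u4, u5, u6, u7)"
    and p: "p \<in> coset5 (n0 + 3 * n1)" and q: "q \<in> coset5 (n0 + 3 * n2)" and r: "r \<in> coset5 (n0 + 3 * n3)"
    and u4: "u4 \<in> coset1 (n2 + n3)" and u5: "u5 \<in> coset1 (n1 + n3)" and u6: "u6 \<in> coset1 (n1 + n2)"
    and u7: "u7 \<in> coset1 (n0 + n1 + n2 + n3)"
    unfolding glued_def by auto
  obtain k4 where k4: "u4 = of_int k4 *\<^sub>R alpha1" "even (k4 - (n2 + n3))" "u4 \<bullet> u4 = (of_int k4)\<^sup>2 / 2"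
    using coset1_norm[OF u4] .
  obtain k5 where k5: "u5 = of_int k5 *\<^sub>R alpha1" "even (k5 - (n1 + n3))" "u5 \<bullet> u5 = (of_int k5)\<^sup>2 / 2"
    using coset1_norm[OF u5] .
  obtain k6 where k6: "u6 = of_int k6 *\<^sub>R alpha1" "even (k6 - (n1 + n2))" "u6 \<bullet> u6 = (of_int k6)\<^sup>2 / 2"
    using coset1_norm[OF u6] .
  obtain k7 where k7: "u7 = of_int k7 *\<^sub>R alpha1" "even (k7 - (n0 + n1 + n2 + n3))"
    using coset1_norm[OF u7] .
  have "(of_int k7 :: real) = 1" using rho unfolding ueq rho_def k7(1) by (simp add: alpha1_inner)
  then have "k7 = 1" by simp
  with k7 have odd: "odd (n0 + n1 + n2 + n3)" and u7eq: "u7 = alpha1" by auto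
  have uvec: "u = vec26 p q r (of_int k4) (of_int k5) (of_int k6)"
    unfolding ueq vec26_def u7eq k4(1) k5(1) k6(1) ..
  have sum: "p \<bullet> p + q \<bullet> q + r \<bullet> r + ((of_int k4)\<^sup>2 + (of_int k5)\<^sup>2 + (of_int k6)\<^sup>2) / 2 = 5/2"
    using norm unfolding uvec vec26_inner by (simp add: power2_eq_square field_simps)
  note shapes = that
  define x where "x = (n0 + 3 * n1) mod 6"
  define y where "y = (n0 + 3 * n2) mod 6"
  define z where "z = (n0 + 3 * n3) mod 6"
  note np = coset5_norm[OF p, of "of_int x", unfolded x_def, OF refl, folded x_def]
  note nq = coset5_norm[OF q, of "of_int y", unfolded y_def, OF refl, folded y_def]
  note nr = coset5_norm[OF r, of "of_int z", unfolded z_def, OF refl, folded z_def]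
  \<comment> \<open>The residues modulo 6 fix the parities of the \<open>A\<^sub>1\<close>
    coefficients, since \<open>n0\<close> cancels modulo 2 in a sum of two residues.\<close>
  have par: "even (k4 - (y + z))" "even (k5 - (x + z))" "even (k6 - (x + y))"
  proof -
    have "even (n mod 6) \<longleftrightarrow> even n" for n :: int by (simp add: dvd_mod_iff)
    then have "even x \<longleftrightarrow> even (n0 + n1)" "even y \<longleftrightarrow> even (n0 + n2)" "even z \<longleftrightarrow> even (n0 + n3)"
      unfolding x_def y_def z_def by simp_all
    then show "even (k4 - (y + z))" "even (k5 - (x + z))" "even (k6 - (x + y))"
      using k4(2) k5(2) k6(2) by auto
  qed
  have o4: "odd (y + z) \<Longrightarrow> (of_int k4 :: real)\<^sup>2 \<ge> 1" using par(1) by (intro odd_square_ge) auto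
  have o5: "odd (x + z) \<Longrightarrow> (of_int k5 :: real)\<^sup>2 \<ge> 1" using par(2) by (intro odd_square_ge) auto
  have o6: "odd (x + y) \<Longrightarrow> (of_int k6 :: real)\<^sup>2 \<ge> 1" using par(3) by (intro odd_square_ge) auto
  have zero: "(\<Sum>i\<in>UNIV. p $ i) = 0" "(\<Sum>i\<in>UNIV. q $ i) = 0" "(\<Sum>i\<in>UNIV. r $ i) = 0"
    using p q r unfolding coset5_def by simp_all
  have sgn: "(of_int k :: real)\<^sup>2 = 1 \<Longrightarrow> (of_int k :: real) \<in> {1, -1}" for k by (auto simp: power2_eq_1_iff)
  have glue: "x = 3 \<and> y = 0 \<and> z = 0 \<Longrightarrow> thesis" "x = 0 \<and> y = 3 \<and> z = 0 \<Longrightarrow> thesis"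
    "x = 0 \<and> y = 0 \<and> z = 3 \<Longrightarrow> thesis"
  proof -
    assume xyz: "x = 3 \<and> y = 0 \<and> z = 0"
    then have bounds: "3/2 \<le> p \<bullet> p" "0 \<le> q \<bullet> q" "0 \<le> r \<bullet> r"
      "0 \<le> (of_int k4 :: real)\<^sup>2" "1 \<le> (of_int k5 :: real)\<^sup>2" "1 \<le> (of_int k6 :: real)\<^sup>2"
      using np(1) o5 o6 by simp_all
    have "5/2 = (3/2 + 0 + 0 + (0 + 1 + 1) / 2 :: real)" by simp
    note eqs = sum_tight[OF bounds sum[unfolded this]]
    have "u = glue_vec1 (p, of_int k5, of_int k6)" unfolding uvec using eqs by simp
    moreover have "p \<in> half_signs" using np(2) eqs(1) xyz zero(1) by (simp add: half_signs_def)
    then have "(p, real_of_int k5, real_of_int k6) \<in> half_signs \<times> {1, -1} \<times> {1, -1}"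
      using sgn[OF eqs(5)] sgn[OF eqs(6)] by (intro SigmaI)
    ultimately show thesis by (intro shapes(2))
  next
    assume xyz: "x = 0 \<and> y = 3 \<and> z = 0"
    then have bounds: "0 \<le> p \<bullet> p" "3/2 \<le> q \<bullet> q" "0 \<le> r \<bullet> r"
      "1 \<le> (of_int k4 :: real)\<^sup>2" "0 \<le> (of_int k5 :: real)\<^sup>2" "1 \<le> (of_int k6 :: real)\<^sup>2"
      using nq(1) o4 o6 by simp_all
    have "5/2 = (0 + 3/2 + 0 + (1 + 0 + 1) / 2 :: real)" by simp
    note eqs = sum_tight[OF bounds sum[unfolded this]]
    have "u = glue_vec2 (q, of_int k4, of_int k6)" unfolding uvec using eqs by simp
    moreover have "q \<in> half_signs" using nq(2) eqs(2) xyz zero(2) by (simp add: half_signs_def)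
    then have "(q, real_of_int k4, real_of_int k6) \<in> half_signs \<times> {1, -1} \<times> {1, -1}"
      using sgn[OF eqs(4)] sgn[OF eqs(6)] by (intro SigmaI)
    ultimately show thesis by (intro shapes(3))
  next
    assume xyz: "x = 0 \<and> y = 0 \<and> z = 3"
    then have bounds: "0 \<le> p \<bullet> p" "0 \<le> q \<bullet> q" "3/2 \<le> r \<bullet> r"
      "1 \<le> (of_int k4 :: real)\<^sup>2" "1 \<le> (of_int k5 :: real)\<^sup>2" "0 \<le> (of_int k6 :: real)\<^sup>2"
      using nr(1) o4 o5 by simp_all
    have "5/2 = (0 + 0 + 3/2 + (1 + 1 + 0) / 2 :: real)" by simp
    note eqs = sum_tight[OF bounds sum[unfolded this]]
    have "u = glue_vec3 (r, of_int k4, of_int k5)" unfolding uvec using eqs by simp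
    moreover have "r \<in> half_signs" using nr(2) eqs(3) xyz zero(3) by (simp add: half_signs_def)
    then have "(r, real_of_int k4, real_of_int k5) \<in> half_signs \<times> {1, -1} \<times> {1, -1}"
      using sgn[OF eqs(4)] sgn[OF eqs(5)] by (intro SigmaI)
    ultimately show thesis by (intro shapes(4))
  qed
  have tri1: thesis if "x = 1 \<and> y = 1 \<and> z = 1"
  proof -
    have bounds: "5/6 \<le> p \<bullet> p" "5/6 \<le> q \<bullet> q" "5/6 \<le> r \<bullet> r"
      "0 \<le> (of_int k4 :: real)\<^sup>2" "0 \<le> (of_int k5 :: real)\<^sup>2" "0 \<le> (of_int k6 :: real)\<^sup>2"
      using np(1) nq(1) nr(1) that by simp_all
    have "5/2 = (5/6 + 5/6 + 5/6 + (0 + 0 + 0) / 2 :: real)" by simp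
    note eqs = sum_tight[OF bounds sum[unfolded this]]
    have v: "p $ i = 1/6 \<or> p $ i = 1/6 - 1" "q $ i = 1/6 \<or> q $ i = 1/6 - 1"
      "r $ i = 1/6 \<or> r $ i = 1/6 - 1" for i
      using np(2)[of i] nq(2)[of i] nr(2)[of i] eqs that by simp_all
    have "\<exists>i. p = simplex_point i" "\<exists>i. q = simplex_point i" "\<exists>i. r = simplex_point i"
      by (rule simplex_point_characterization[OF zero(1) v(1)] simplex_point_characterization[OF zero(2) v(2)]
          simplex_point_characterization[OF zero(3) v(3)])+
    then obtain i j k where "p = simplex_point i" "q = simplex_point j" "r = simplex_point k" by auto
    then have "u = triple_vec 1 (i, j, k)" unfolding uvec using eqs by simp
    then show thesis using shapes(1) by blast
  qed
  have tri5: thesis if "x = 5 \<and> y = 5 \<and> z = 5"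
  proof -
    have bounds: "5/6 \<le> p \<bullet> p" "5/6 \<le> q \<bullet> q" "5/6 \<le> r \<bullet> r"
      "0 \<le> (of_int k4 :: real)\<^sup>2" "0 \<le> (of_int k5 :: real)\<^sup>2" "0 \<le> (of_int k6 :: real)\<^sup>2"
      using np(1) nq(1) nr(1) that by simp_all
    have "5/2 = (5/6 + 5/6 + 5/6 + (0 + 0 + 0) / 2 :: real)" by simp
    note eqs = sum_tight[OF bounds sum[unfolded this]]
    \<comment> \<open>Residue 5 is the class of -1, so the negated vectors are simplex
      points.\<close>
    have v: "(- p) $ i = 1/6 \<or> (- p) $ i = 1/6 - 1" "(- q) $ i = 1/6 \<or> (- q) $ i = 1/6 - 1"
      "(- r) $ i = 1/6 \<or> (- r) $ i = 1/6 - 1" for i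
      using np(2)[of i] nq(2)[of i] nr(2)[of i] eqs that by auto
    have "\<exists>i. - p = simplex_point i" "\<exists>i. - q = simplex_point i" "\<exists>i. - r = simplex_point i"
      using zero by (intro simplex_point_characterization v; simp add: sum_negf)+
    then obtain i j k where "p = - simplex_point i" "q = - simplex_point j" "r = - simplex_point k"
      by (metis minus_minus)
    then have "u = triple_vec (-1) (i, j, k)" unfolding uvec using eqs by simp
    then show thesis using shapes(1) by blast
  qed
  have "(x, y, z) \<in> {(1,1,1), (5,5,5), (3,0,0), (0,3,0), (0,0,3),
      (3,3,3), (1,4,4), (4,1,4), (4,4,1), (5,2,2), (2,5,2), (2,2,5)}"
    using glue_residues[OF odd] unfolding x_def y_def z_def .
  \<comment> \<open>The minimal norms of the excluded triples add up to 9/2 or 7/2.\<close>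
  moreover have "p \<bullet> p + q \<bullet> q + r \<bullet> r \<le> 5/2"
    unfolding sum[symmetric] by simp
  then have "(x, y, z) \<notin> {(3,3,3), (1,4,4), (4,1,4), (4,4,1), (5,2,2), (2,5,2), (2,2,5)}"
    using np(1) nq(1) nr(1) by auto
  ultimately show thesis using glue tri1 tri5 by (elim insertE emptyE) simp_all
qed

declare triple_vec.simps [simp del]
section \<open>Affine equiangular sets\<close>

text \<open>The sign can be forgotten: the two signs of one triple give inner product -2, so at most
  one of them occurs.\<close>

definition triple_part :: "R26 set \<Rightarrow> (6 \<times> 6 \<times> 6) set" where
  "triple_part \<omega> = {z. triple_vec 1 z \<in> \<omega> \<or> triple_vec (-1) z \<in> \<omega>}"

definition glue_part :: "((real^6) \<times> real \<times> real \<Rightarrow> R26) \<Rightarrow> R26 set \<Rightarrow> ((real^6) \<times> real \<times> real) set" where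
  "glue_part f \<omega> = {w \<in> half_signs \<times> {1, -1} \<times> {1, -1}. f w \<in> \<omega>}"

lemma affine_equiangular3_inner:
  assumes \<omega>: "affine_equiangular3 rho \<omega>" and u: "u \<in> \<omega>" and v: "v \<in> \<omega>" and ne: "u \<noteq> v"
  shows "u \<bullet> v = 0 \<or> u \<bullet> v = 1"
proof -
  have "\<forall>u\<in>\<omega>. \<forall>v\<in>\<omega>. u \<noteq> v \<longrightarrow> u \<bullet> v \<in> {0, 1}" using \<omega> unfolding affine_equiangular3_def ..
  then have "u \<bullet> v \<in> {0, 1}" using u v ne by (metis (no_types))
  then show ?thesis by simp
qed

text \<open>Admitting the value 3 covers pairs not known to be distinct.\<close>

lemma affine_equiangular3_inner3:
  assumes "affine_equiangular3 rho \<omega>" "u \<in> \<omega>" "v \<in> \<omega>"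
  shows "u \<bullet> v \<in> {0, 1, 3}"
proof (cases "u = v")
  case True
  have "\<forall>u\<in>\<omega>. u \<bullet> rho = 1 \<and> u \<bullet> u = 3" using assms(1) unfolding affine_equiangular3_def ..
  then show ?thesis using assms True by simp
next
  case False
  from affine_equiangular3_inner[OF assms this] show ?thesis by (elim disjE) simp_all
qed

text \<open>Distinct triples that agree in two positions would have inner product 2 or -1.\<close>

lemma triple_part_agree:
  assumes \<omega>: "affine_equiangular3 rho \<omega>" and "(i, j, k) \<in> triple_part \<omega>" "(i', j', k') \<in> triple_part \<omega>"
    and two: "(i = i' \<and> j = j') \<or> (i = i' \<and> k = k') \<or> (j = j' \<and> k = k')"
  shows "(i, j, k) = (i', j', k')"
proof (rule ccontr)
  assume ne: "(i, j, k) \<noteq> (i', j', k')"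
  obtain \<sigma> \<tau> where s: "\<sigma> \<in> {1, -1}" "\<tau> \<in> {1, -1}"
    "triple_vec \<sigma> (i, j, k) \<in> \<omega>" "triple_vec \<tau> (i', j', k') \<in> \<omega>"
    using assms unfolding triple_part_def by blast
  have "triple_vec \<sigma> (i, j, k) \<bullet> triple_vec \<tau> (i', j', k') = \<sigma> * \<tau> * (3/2) + 1/2"
  proof -
    have "of_bool (i = i') + of_bool (j = j') + of_bool (k = k') = (2 :: real)" using two ne by auto
    then show ?thesis unfolding triple_vec_inner by simp
  qed
  moreover have "\<sigma> * \<tau> = 1 \<or> \<sigma> * \<tau> = -1" using s(1,2) by auto
  ultimately show False using affine_equiangular3_inner3[OF \<omega> s(3,4)] by auto
qed

text \<open>Any two positions determine the third, as in a partial Latin square; there are 36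
  pairs.\<close>

lemma card_triple_part:
  assumes \<omega>: "affine_equiangular3 rho \<omega>"
  shows "inj_on (\<lambda>(i, j, k). (i, j)) (triple_part \<omega>)" "inj_on (\<lambda>(i, j, k). (i, k)) (triple_part \<omega>)"
    "inj_on (\<lambda>(i, j, k). (j, k)) (triple_part \<omega>)" "card (triple_part \<omega>) \<le> 36"
proof -
  have inj: "inj_on f (triple_part \<omega>)"
    if "\<And>i j k i' j' k'. f (i, j, k) = f (i', j', k') \<Longrightarrow>
      (i = i' \<and> j = j') \<or> (i = i' \<and> k = k') \<or> (j = j' \<and> k = k')" for f :: "6 \<times> 6 \<times> 6 \<Rightarrow> 6 \<times> 6"
  proof (rule inj_onI)
    fix z z' assume z: "z \<in> triple_part \<omega>" "z' \<in> triple_part \<omega>" "f z = f z'"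
    obtain i j k i' j' k' where eq: "z = (i, j, k)" "z' = (i', j', k')" by (cases z, cases z')
    show "z = z'"
      using triple_part_agree[OF \<omega> z(1)[unfolded eq] z(2)[unfolded eq] that[OF z(3)[unfolded eq]]]
      unfolding eq .
  qed
  show "inj_on (\<lambda>(i, j, k). (i, j)) (triple_part \<omega>)" "inj_on (\<lambda>(i, j, k). (i, k)) (triple_part \<omega>)"
    "inj_on (\<lambda>(i, j, k). (j, k)) (triple_part \<omega>)"
    by (rule inj; simp)+
  have "card (triple_part \<omega>) \<le> card (UNIV :: (6 \<times> 6) set)"
    by (rule card_inj_on_le[of "\<lambda>(i, j, k). (i, j)"]) ((rule inj, simp)?, simp)+
  then show "card (triple_part \<omega>) \<le> 36" by simp
qed

text \<open>The map \<open>f\<close> stands for any of the three glue embeddings, so one proof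
  serves all three blocks.\<close>

lemma glue_part_config:
  assumes \<omega>: "affine_equiangular3 rho \<omega>"
    and inner: "\<And>s a b s' a' b'. f (s, a, b) \<bullet> f (s', a', b') = s \<bullet> s' + (a * a' + b * b' + 1) / 2"
    and inj: "inj f"
  shows "glue_config (glue_part f \<omega>)"
  unfolding glue_config_def
proof (intro conjI)
  show "glue_part f \<omega> \<subseteq> half_signs \<times> {1, -1} \<times> {1, -1}" unfolding glue_part_def by blast
  have "\<bar>s \<bullet> s' + (a * a' + b * b') / 2\<bar> = 1/2"
    if m: "(s, a, b) \<in> glue_part f \<omega>" "(s', a', b') \<in> glue_part f \<omega>" "(s, a, b) \<noteq> (s', a', b')"
    for s a b s' a' b'
  proof -
    have "f (s, a, b) \<bullet> f (s', a', b') = 0 \<or> f (s, a, b) \<bullet> f (s', a', b') = 1"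
      by (rule affine_equiangular3_inner[OF \<omega>]) (use m inj in \<open>auto simp: glue_part_def dest: injD\<close>)
    then have "s \<bullet> s' + (a * a' + b * b') / 2 = - 1/2 \<or> s \<bullet> s' + (a * a' + b * b') / 2 = 1/2"
      unfolding inner add_divide_distrib by linarith
    moreover have "\<bar>y\<bar> = 1/2" if "y = - 1/2 \<or> y = 1/2" for y :: real using that by auto
    ultimately show ?thesis by blast
  qed
  then show "\<forall>(s, a, b)\<in>glue_part f \<omega>. \<forall>(s', a', b')\<in>glue_part f \<omega>. (s, a, b) \<noteq> (s', a', b') \<longrightarrow>
      \<bar>s \<bullet> s' + (a * a' + b * b') / 2\<bar> = 1/2" by blast
qed

lemma glue_vec_inner:
  "glue_vec1 (s, a, b) \<bullet> glue_vec1 (s', a', b') = s \<bullet> s' + (a * a' + b * b' + 1) / 2"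
  "glue_vec2 (s, a, b) \<bullet> glue_vec2 (s', a', b') = s \<bullet> s' + (a * a' + b * b' + 1) / 2"
  "glue_vec3 (s, a, b) \<bullet> glue_vec3 (s', a', b') = s \<bullet> s' + (a * a' + b * b' + 1) / 2"
  by (simp_all add: vec26_inner)

lemma inj_glue_vec: "inj glue_vec1" "inj glue_vec2" "inj glue_vec3"
  by (auto intro!: injI simp: vec26_eq_iff)

lemmas glue_parts_config =
  glue_part_config[OF _ glue_vec_inner(1) inj_glue_vec(1)]
  glue_part_config[OF _ glue_vec_inner(2) inj_glue_vec(2)]
  glue_part_config[OF _ glue_vec_inner(3) inj_glue_vec(3)]

lemma card_affine_equiangular_L:
  assumes \<omega>: "affine_equiangular3 rho \<omega>" and L: "\<omega> \<subseteq> L"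
  shows "finite \<omega>"
    and "card \<omega> \<le> card (triple_part \<omega>) + card (glue_part glue_vec1 \<omega>)
      + card (glue_part glue_vec2 \<omega>) + card (glue_part glue_vec3 \<omega>)"
proof -
  \<comment> \<open>The choice of sign is forced, so the images of the four parts cover
    \<omega>.\<close>
  define g where "g = (\<lambda>z. if triple_vec 1 z \<in> \<omega> then triple_vec 1 z else triple_vec (-1) z)"
  let ?S = "g ` triple_part \<omega> \<union> glue_vec1 ` glue_part glue_vec1 \<omega> \<union> glue_vec2 ` glue_part glue_vec2 \<omega>
    \<union> glue_vec3 ` glue_part glue_vec3 \<omega>"
  have sub: "\<omega> \<subseteq> ?S"
  proof
    fix u assume u: "u \<in> \<omega>"
    then have "u \<in> L" "u \<bullet> rho = 1" "u \<bullet> u = 3"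
      using L \<omega> unfolding affine_equiangular3_def by auto
    then show "u \<in> ?S"
    proof (cases rule: short_vector_cases)
      case (1 \<sigma> z)
      have "u = g z"
      proof (rule ccontr)
        assume ne: "u \<noteq> g z"
        then have "triple_vec 1 z \<in> \<omega>" "u = triple_vec (-1) z" using 1 u unfolding g_def by (auto split: if_splits)
        moreover obtain i j k where "z = (i, j, k)" by (cases z)
        ultimately show False
          using affine_equiangular3_inner3[OF \<omega> u, of "triple_vec 1 z"] by (simp only: triple_vec_inner) simp
      qed
      moreover have "z \<in> triple_part \<omega>" using 1 u unfolding triple_part_def by auto
      ultimately show ?thesis by blast
    qed (use u in \<open>auto simp: glue_part_def\<close>)
  qed
  have fin: "finite (glue_part glue_vec1 \<omega>)" "finite (glue_part glue_vec2 \<omega>)" "finite (glue_part glue_vec3 \<omega>)"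
    by (rule finite_glue_config[OF glue_parts_config(1)[OF \<omega>]] finite_glue_config[OF glue_parts_config(2)[OF \<omega>]]
        finite_glue_config[OF glue_parts_config(3)[OF \<omega>]])+
  have finZ: "finite (triple_part \<omega>)" by simp
  show "finite \<omega>" by (rule finite_subset[OF sub]) (use fin finZ in simp)
  have "card \<omega> \<le> card ?S" by (rule card_mono[OF _ sub]) (use fin finZ in simp)
  also have "\<dots> \<le> card (g ` triple_part \<omega>) + card (glue_vec1 ` glue_part glue_vec1 \<omega>)
      + card (glue_vec2 ` glue_part glue_vec2 \<omega>) + card (glue_vec3 ` glue_part glue_vec3 \<omega>)"
    by (meson add_le_mono card_Un_le le_refl order_trans)
  also have "\<dots> \<le> card (triple_part \<omega>) + card (glue_part glue_vec1 \<omega>)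
      + card (glue_part glue_vec2 \<omega>) + card (glue_part glue_vec3 \<omega>)"
    by (intro add_mono card_image_le fin finZ)
  finally show "card \<omega> \<le> card (triple_part \<omega>) + card (glue_part glue_vec1 \<omega>)
      + card (glue_part glue_vec2 \<omega>) + card (glue_part glue_vec3 \<omega>)" .
qed

text \<open>All of \<open>L\<close> lies in a product of hyperplanes and lines, which is a subspace;
  the inner product with \<rho> then fixes the last coefficient.\<close>

lemma span_L_vec26:
  assumes "x \<in> span L" "x \<bullet> rho = 1"
  obtains p q r t1 t2 t3 where "x = vec26 p q r t1 t2 t3"
    "(\<Sum>i\<in>UNIV. p $ i) = 0" "(\<Sum>i\<in>UNIV. q $ i) = 0" "(\<Sum>i\<in>UNIV. r $ i) = 0"
proof -
  define Z where "Z = {v :: real^6. (\<Sum>i\<in>UNIV. v $ i) = 0}"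
  define A where "A = span {alpha1}"
  have Z: "subspace Z" unfolding subspace_def Z_def by (auto simp: sum.distrib simp flip: sum_distrib_left)
  have A: "subspace A" unfolding A_def by simp
  have "L \<subseteq> Z \<times> Z \<times> Z \<times> A \<times> A \<times> A \<times> A"
  proof
    fix u assume "u \<in> L"
    then obtain n0 n1 n2 n3 where "u \<in> glued n0 n1 n2 n3" by (rule L_glued)
    moreover have "coset5 m \<subseteq> Z" "coset1 m \<subseteq> A" for m
      unfolding coset5_def Z_def coset1_def A_def by (auto simp: span_base span_scale)
    ultimately show "u \<in> Z \<times> Z \<times> Z \<times> A \<times> A \<times> A \<times> A" unfolding glued_def by blast
  qed
  then have "span L \<subseteq> Z \<times> Z \<times> Z \<times> A \<times> A \<times> A \<times> A"
    by (rule span_minimal) (intro subspace_Times Z A)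
  with assms(1) have "x \<in> Z \<times> Z \<times> Z \<times> A \<times> A \<times> A \<times> A" by (rule rev_subsetD)
  then obtain p q r v1 v2 v3 v4 where "x = (p, q, r, v1, v2, v3, v4)"
    and Zs: "p \<in> Z" "q \<in> Z" "r \<in> Z" and "v1 \<in> A" "v2 \<in> A" "v3 \<in> A" "v4 \<in> A"
    by (elim SigmaE) blast
  then obtain t1 t2 t3 t4 where
    x: "x = (p, q, r, t1 *\<^sub>R alpha1, t2 *\<^sub>R alpha1, t3 *\<^sub>R alpha1, t4 *\<^sub>R alpha1)"
    unfolding A_def span_singleton by blast
  moreover note Zs
  moreover have "t4 = 1" using assms(2) unfolding x rho_def by (simp add: alpha1_inner)
  ultimately show thesis using that unfolding Z_def vec26_def by auto
qed

lemma no_extension: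
  assumes \<omega>: "affine_equiangular3 rho \<omega>"
    and cards: "card (triple_part \<omega>) = 36" "card (glue_part glue_vec1 \<omega>) = 7"
      "card (glue_part glue_vec2 \<omega>) = 7" "card (glue_part glue_vec3 \<omega>) = 7"
    and x: "x \<in> span L" "x \<bullet> rho = 1" "x \<bullet> x = 3"
    and inner: "\<And>u. u \<in> \<omega> \<Longrightarrow> x \<bullet> u \<in> {0, 1}"
  shows False
proof -
  obtain p q r t1 t2 t3 where xeq: "x = vec26 p q r t1 t2 t3"
    and sum: "(\<Sum>i\<in>UNIV. p $ i) = 0" "(\<Sum>i\<in>UNIV. q $ i) = 0" "(\<Sum>i\<in>UNIV. r $ i) = 0"
    using span_L_vec26[OF x(1,2)] .
  have "\<bar>p $ i + q $ j + r $ k\<bar> = 1/2" if ijk: "(i, j, k) \<in> triple_part \<omega>" for i j k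
  proof -
    from ijk obtain \<sigma> where \<sigma>: "\<sigma> = 1 \<or> \<sigma> = -1" "triple_vec \<sigma> (i, j, k) \<in> \<omega>"
      unfolding triple_part_def by blast
    have "1/2 - \<sigma> * (p $ i + q $ j + r $ k) \<in> {0, 1}"
      using inner[OF \<sigma>(2)] unfolding xeq vec26_triple_inner[OF sum] .
    then show ?thesis using \<sigma>(1) by auto
  qed
  then have "p \<bullet> p + q \<bullet> q + r \<bullet> r = 3/2"
    using orthogonal_array_energy[OF card_triple_part(1-3)[OF \<omega>] cards(1) sum] by blast
  \<comment> \<open>Here 3 = 3/2 + (t + 1)/2, where t is the sum of the three squares.\<close>
  then have t: "t1\<^sup>2 + t2\<^sup>2 + t3\<^sup>2 = 2"
    using x(3) unfolding xeq vec26_inner by (simp add: power2_eq_square field_simps)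
  have half: "\<bar>y\<bar> = 1/2" if "y + 1/2 \<in> {0, 1}" for y :: real using that by auto
  have "t2\<^sup>2 + t3\<^sup>2 < 4/3"
  proof (rule glue_config_bound[OF glue_parts_config(1)[OF \<omega>] cards(2)])
    fix s a b assume "(s, a, b) \<in> glue_part glue_vec1 \<omega>"
    then have "x \<bullet> glue_vec1 (s, a, b) \<in> {0, 1}" unfolding glue_part_def by (intro inner) simp
    then show "\<bar>p \<bullet> s + (a * t2 + b * t3) / 2\<bar> = 1/2"
      by (intro half) (simp add: xeq vec26_inner add_divide_distrib algebra_simps)
  qed
  moreover have "t1\<^sup>2 + t3\<^sup>2 < 4/3"
  proof (rule glue_config_bound[OF glue_parts_config(2)[OF \<omega>] cards(3)])
    fix s a b assume "(s, a, b) \<in> glue_part glue_vec2 \<omega>"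
    then have "x \<bullet> glue_vec2 (s, a, b) \<in> {0, 1}" unfolding glue_part_def by (intro inner) simp
    then show "\<bar>q \<bullet> s + (a * t1 + b * t3) / 2\<bar> = 1/2"
      by (intro half) (simp add: xeq vec26_inner add_divide_distrib algebra_simps)
  qed
  moreover have "t1\<^sup>2 + t2\<^sup>2 < 4/3"
  proof (rule glue_config_bound[OF glue_parts_config(3)[OF \<omega>] cards(4)])
    fix s a b assume "(s, a, b) \<in> glue_part glue_vec3 \<omega>"
    then have "x \<bullet> glue_vec3 (s, a, b) \<in> {0, 1}" unfolding glue_part_def by (intro inner) simp
    then show "\<bar>r \<bullet> s + (a * t1 + b * t2) / 2\<bar> = 1/2"
      by (intro half) (simp add: xeq vec26_inner add_divide_distrib algebra_simps)
  qed
  ultimately show False using t by linarith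
qed

lemmas glue_vec_simps = glue_vec1.simps glue_vec2.simps glue_vec3.simps
declare glue_vec_simps [simp del]

section \<open>A set of 57 vectors\<close>

definition half_vec :: "6 set \<Rightarrow> real^6" where
  "half_vec S = (\<chi> i. if i \<in> S then - 1/2 else 1/2)"

text \<open>Blocks with \<open>m\<close> common points give sign vectors with inner product
  \<open>m - 3/2\<close>. Blocks of equal sign meet in one point, blocks of opposite sign in one or
  two, so the classes have sizes 4 and 3.\<close>

definition example_blocks :: "(6 set \<times> real) set" where
  "example_blocks = {({0,1,2}, 1), ({0,4,5}, 1), ({1,3,5}, 1), ({2,3,4}, 1),
     ({0,1,3}, -1), ({1,2,4}, -1), ({0,2,5}, -1)}"

definition example_glue :: "((real^6) \<times> real \<times> real) set" where
  "example_glue = (\<lambda>(S, b). (half_vec S, 1, b)) ` example_blocks"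

text \<open>The Latin square is, up to sign, the addition table of \<open>\<int>/6\<close>, which is the arithmetic of the index type.\<close>
definition example_set :: "R26 set" where
  "example_set = (\<lambda>(i, j). triple_vec 1 (i, j, - (i + j))) ` UNIV \<union>
     glue_vec1 ` example_glue \<union> glue_vec2 ` example_glue \<union> glue_vec3 ` example_glue"

section \<open>Verification of the example\<close>

lemma half_vec_inner:
  "half_vec S \<bullet> half_vec T = (\<Sum>i\<in>{0,1,2,3,4,5}. (if (i \<in> S) = (i \<in> T) then 1/4 else - 1/4))"
  unfolding inner_vec_def UNIV_6 by (rule sum.cong) (auto simp: half_vec_def)

lemma half_vec_half_signs:
  "(\<Sum>i\<in>{0,1,2,3,4,5}. (if i \<in> S then - 1/2 else 1/2 :: real)) = 0 \<Longrightarrow> half_vec S \<in> half_signs"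
  unfolding half_signs_def half_vec_def UNIV_6 by auto

lemma example_glue_half_signs: "example_glue \<subseteq> half_signs \<times> {1, -1} \<times> {1, -1}"
  unfolding example_glue_def example_blocks_def by (auto intro!: half_vec_half_signs)

lemma example_glue_inner:
  assumes "(s, a, b) \<in> example_glue" "(s', a', b') \<in> example_glue" "(s, a, b) \<noteq> (s', a', b')"
  shows "s \<bullet> s' + (a * a' + b * b') / 2 = 1/2 \<or> s \<bullet> s' + (a * a' + b * b') / 2 = - 1/2"
  using assms unfolding example_glue_def example_blocks_def image_insert image_empty
  by (elim insertE emptyE) (simp_all add: half_vec_inner)

lemma half_vec_eq_iff: "half_vec S = half_vec T \<longleftrightarrow> S = T"
  by (auto simp: half_vec_def vec_eq_iff split: if_splits)

lemma card_example_glue: "card example_glue = 7"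
proof -
  have "inj_on (\<lambda>(S, b). (half_vec S, 1 :: real, b)) example_blocks"
    by (auto intro!: inj_onI simp: half_vec_eq_iff)
  then have "card example_glue = card example_blocks" unfolding example_glue_def by (rule card_image)
  also have "example_blocks = set [({0,1,2}, 1), ({0,4,5}, 1), ({1,3,5}, 1), ({2,3,4}, 1),
      ({0,1,3}, -1), ({1,2,4}, -1), ({0,2,5}, -1)]" (is "_ = set ?xs")
    by (simp add: example_blocks_def)
  also have "card (set ?xs) = length ?xs"
    by (rule distinct_card) (auto simp: set_eq_iff all_6)
  finally show ?thesis by simp
qed

lemma triple_vec_L: "triple_vec 1 (i, j, k) \<in> L"
proof (rule L_memI[of beta0])
  have "simplex_point i - alpha5 \<in> root_lattice_A" for i
    using coset5_add[OF simplex_point_coset5[of i] coset5_scale[OF simplex_point_coset5[of 0] refl, of "-1"], of 0]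
    unfolding root_lattice_A_coset5 alpha5_eq by simp
  then show "triple_vec 1 (i, j, k) - beta0 \<in> Lambda"
    unfolding Lambda_def beta0_def by (simp add: triple_vec.simps vec26_def root_lattice_A_coset1 zero_coset zero_prod_def)
qed simp

text \<open>Entries 1/2 and -1/2 are congruent to 3/6, so \<open>s\<close> differs from
  \<open>3 *\<^sub>R alpha5\<close> by a root lattice vector; changing the sign of
  \<open>alpha1\<close> subtracts a root.\<close>

lemma glue_vec_L:
  assumes "w \<in> half_signs \<times> {1, -1} \<times> {1, -1}"
  shows "glue_vec1 w \<in> L" "glue_vec2 w \<in> L" "glue_vec3 w \<in> L"
proof -
  from assms obtain s a b where w: "w = (s, a, b)" and s: "s \<in> half_signs" and ab: "a \<in> {1, -1}" "b \<in> {1, -1}" by auto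
  have "s $ i - 3 / 6 \<in> \<int>" for i
  proof -
    have "s $ i = 1/2 \<or> s $ i = - 1/2" using s unfolding half_signs_def by blast
    then show ?thesis by (elim disjE; simp only:; simp)
  qed
  then have "s \<in> coset5 3" using s unfolding coset5_def half_signs_def by simp
  then have s: "s - 3 *\<^sub>R alpha5 \<in> root_lattice_A"
    using coset5_add[OF _ coset5_scale[OF simplex_point_coset5[of 0] refl, of "-3"], of s 3 0]
    unfolding root_lattice_A_coset5 alpha5_eq by simp
  have c: "c *\<^sub>R alpha1 - alpha1 \<in> root_lattice_A" if "c \<in> {1, -1}" for c :: real
  proof -
    have "(-2) *\<^sub>R alpha1 \<in> coset1 0" unfolding coset1_def by (auto intro!: exI[of _ "-2"])
    moreover have "- alpha1 - alpha1 = (-2) *\<^sub>R alpha1" by (simp add: scaleR_2)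
    ultimately show ?thesis using that zero_coset(2) unfolding root_lattice_A_coset1 by auto
  qed
  have z: "0 \<in> (root_lattice_A :: (real^6) set)" "0 \<in> (root_lattice_A :: (real^2) set)"
    unfolding root_lattice_A_coset5 root_lattice_A_coset1 by (rule zero_coset)+
  show "glue_vec1 w \<in> L"
    by (rule L_memI[of beta1]) (use s c[OF ab(1)] c[OF ab(2)] z in \<open>simp_all add: w glue_vec_simps vec26_def beta1_def Lambda_def zero_prod_def\<close>)
  show "glue_vec2 w \<in> L"
    by (rule L_memI[of beta2]) (use s c[OF ab(1)] c[OF ab(2)] z in \<open>simp_all add: w glue_vec_simps vec26_def beta2_def Lambda_def zero_prod_def\<close>)
  show "glue_vec3 w \<in> L"
    by (rule L_memI[of beta3]) (use s c[OF ab(1)] c[OF ab(2)] z in \<open>simp_all add: w glue_vec_simps vec26_def beta3_def Lambda_def zero_prod_def\<close>)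
qed

text \<open>Besides the last block only one \<open>A\<^sub>5\<close> block overlaps, so the value is
  1/2 minus an entry of \<open>s\<close>.\<close>

lemma triple_glue_inner:
  assumes s: "s \<in> half_signs"
  shows "triple_vec 1 (i, j, k) \<bullet> glue_vec1 (s, a, b) \<in> {0, 1}"
    "triple_vec 1 (i, j, k) \<bullet> glue_vec2 (s, a, b) \<in> {0, 1}"
    "triple_vec 1 (i, j, k) \<bullet> glue_vec3 (s, a, b) \<in> {0, 1}"
proof -
  have z: "(\<Sum>i\<in>UNIV. s $ i) = 0" "(\<Sum>i\<in>UNIV. (0::real^6) $ i) = 0"
    and v: "s $ i = 1/2 \<or> s $ i = - 1/2" for i
    using s unfolding half_signs_def by simp_all
  show "triple_vec 1 (i, j, k) \<bullet> glue_vec1 (s, a, b) \<in> {0, 1}"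
    using v[of i] by (simp add: inner_commute[of "triple_vec 1 (i, j, k)"] glue_vec_simps vec26_triple_inner z) auto
  show "triple_vec 1 (i, j, k) \<bullet> glue_vec2 (s, a, b) \<in> {0, 1}"
    using v[of j] by (simp add: inner_commute[of "triple_vec 1 (i, j, k)"] glue_vec_simps vec26_triple_inner z) auto
  show "triple_vec 1 (i, j, k) \<bullet> glue_vec3 (s, a, b) \<in> {0, 1}"
    using v[of k] by (simp add: inner_commute[of "triple_vec 1 (i, j, k)"] glue_vec_simps vec26_triple_inner z) auto
qed

text \<open>Besides the last block exactly one \<open>A\<^sub>1\<close> block overlaps, so the value
  is half of 1 plus a sign.\<close>

lemma glue_glue_inner:
  assumes "a \<in> {1, -1}" "b \<in> {1, -1}" "a' \<in> {1, -1}" "b' \<in> {1, -1}"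
  shows "glue_vec1 (s, a, b) \<bullet> glue_vec2 (s', a', b') \<in> {0, 1}"
    "glue_vec1 (s, a, b) \<bullet> glue_vec3 (s', a', b') \<in> {0, 1}"
    "glue_vec2 (s, a, b) \<bullet> glue_vec3 (s', a', b') \<in> {0, 1}"
  using assms by (auto simp: glue_vec_simps vec26_inner)

text \<open>Distinct triples of the addition table agree in at most one position.\<close>

lemma example_triples_inner:
  assumes "(i, j) \<noteq> (i', j')"
  shows "triple_vec 1 (i, j, - (i + j)) \<bullet> triple_vec 1 (i', j', - (i' + j')) \<in> {0, 1}"
proof -
  have "\<not> (i = i' \<and> i + j = i' + j')" "\<not> (j = j' \<and> i + j = i' + j')" "\<not> (i = i' \<and> j = j')"
    using assms by auto
  then show ?thesis unfolding triple_vec_inner by auto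
qed

lemma example_set_equiangular: "affine_equiangular3 rho example_set"
proof -
  define P where "P = range (\<lambda>(i, j). triple_vec 1 (i, j, - (i + j)))"
  define G1 G2 G3 where "G1 = glue_vec1 ` example_glue" and "G2 = glue_vec2 ` example_glue"
    and "G3 = glue_vec3 ` example_glue"
  \<comment> \<open>Symmetrising lets each pair of kinds be treated in one order only.\<close>
  define J where "J = (\<lambda>u v :: R26. u \<bullet> v \<in> {0, 1} \<and> v \<bullet> u \<in> {0, 1})"
  have g: "s \<in> half_signs" "a \<in> {1, -1}" "b \<in> {1, -1}" if "(s, a, b) \<in> example_glue" for s a b
    using that example_glue_half_signs by auto
  have JI: "J u v" if "u \<bullet> v \<in> {0, 1}" for u v using that by (simp add: J_def inner_commute)
  have P1: "J u v" if uv: "u \<in> P" "v \<in> G1" for u v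
  proof -
    from uv obtain i j s a b where eq: "u = triple_vec 1 (i, j, - (i + j))" "v = glue_vec1 (s, a, b)"
      and m: "(s, a, b) \<in> example_glue" unfolding P_def G1_def by auto
    show ?thesis unfolding eq by (rule JI, rule triple_glue_inner(1)[OF g(1)[OF m]])
  qed
  have P2: "J u v" if uv: "u \<in> P" "v \<in> G2" for u v
  proof -
    from uv obtain i j s a b where eq: "u = triple_vec 1 (i, j, - (i + j))" "v = glue_vec2 (s, a, b)"
      and m: "(s, a, b) \<in> example_glue" unfolding P_def G2_def by auto
    show ?thesis unfolding eq by (rule JI, rule triple_glue_inner(2)[OF g(1)[OF m]])
  qed
  have P3: "J u v" if uv: "u \<in> P" "v \<in> G3" for u v
  proof -
    from uv obtain i j s a b where eq: "u = triple_vec 1 (i, j, - (i + j))" "v = glue_vec3 (s, a, b)"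
      and m: "(s, a, b) \<in> example_glue" unfolding P_def G3_def by auto
    show ?thesis unfolding eq by (rule JI, rule triple_glue_inner(3)[OF g(1)[OF m]])
  qed
  have 12: "J u v" if uv: "u \<in> G1" "v \<in> G2" for u v
  proof -
    from uv obtain s a b s' a' b' where eq: "u = glue_vec1 (s, a, b)" "v = glue_vec2 (s', a', b')"
      and m: "(s, a, b) \<in> example_glue" "(s', a', b') \<in> example_glue" unfolding G1_def G2_def by auto
    show ?thesis unfolding eq
      by (rule JI, rule glue_glue_inner(1)[OF g(2)[OF m(1)] g(3)[OF m(1)] g(2)[OF m(2)] g(3)[OF m(2)]])
  qed
  have 13: "J u v" if uv: "u \<in> G1" "v \<in> G3" for u v
  proof -
    from uv obtain s a b s' a' b' where eq: "u = glue_vec1 (s, a, b)" "v = glue_vec3 (s', a', b')"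
      and m: "(s, a, b) \<in> example_glue" "(s', a', b') \<in> example_glue" unfolding G1_def G3_def by auto
    show ?thesis unfolding eq
      by (rule JI, rule glue_glue_inner(2)[OF g(2)[OF m(1)] g(3)[OF m(1)] g(2)[OF m(2)] g(3)[OF m(2)]])
  qed
  have 23: "J u v" if uv: "u \<in> G2" "v \<in> G3" for u v
  proof -
    from uv obtain s a b s' a' b' where eq: "u = glue_vec2 (s, a, b)" "v = glue_vec3 (s', a', b')"
      and m: "(s, a, b) \<in> example_glue" "(s', a', b') \<in> example_glue" unfolding G2_def G3_def by auto
    show ?thesis unfolding eq
      by (rule JI, rule glue_glue_inner(3)[OF g(2)[OF m(1)] g(3)[OF m(1)] g(2)[OF m(2)] g(3)[OF m(2)]])
  qed
  have PP: "J u v" if uv: "u \<in> P" "v \<in> P" "u \<noteq> v" for u v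
  proof -
    from uv obtain i j i' j' where "u = triple_vec 1 (i, j, - (i + j))" "v = triple_vec 1 (i', j', - (i' + j'))"
      unfolding P_def by auto
    moreover from this uv have "(i, j) \<noteq> (i', j')" by blast
    ultimately show ?thesis using example_triples_inner[of i j i' j'] by (simp add: J_def inner_commute)
  qed
  have half: "y + 1/2 \<in> {0, 1}" if "y = 1/2 \<or> y = - 1/2" for y :: real using that by auto
  have same: "J (f w) (f w')"
    if f: "\<And>s a b s' a' b'. f (s, a, b) \<bullet> f (s', a', b') = s \<bullet> s' + (a * a' + b * b' + 1) / 2"
      and w: "w \<in> example_glue" "w' \<in> example_glue" "w \<noteq> w'" for f w w'
  proof -
    obtain s a b s' a' b' where eq: "w = (s, a, b)" "w' = (s', a', b')" by (cases w, cases w')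
    have "f w \<bullet> f w' = (s \<bullet> s' + (a * a' + b * b') / 2) + 1/2" unfolding eq f by (simp add: add_divide_distrib)
    also have "\<dots> \<in> {0, 1}" using half[OF example_glue_inner] w unfolding eq by blast
    finally show ?thesis by (simp add: J_def inner_commute)
  qed
  have 11: "J u v" if "u \<in> G1" "v \<in> G1" "u \<noteq> v" for u v
    using that same[OF glue_vec_inner(1)] unfolding G1_def by blast
  have 22: "J u v" if "u \<in> G2" "v \<in> G2" "u \<noteq> v" for u v
    using that same[OF glue_vec_inner(2)] unfolding G2_def by blast
  have 33: "J u v" if "u \<in> G3" "v \<in> G3" "u \<noteq> v" for u v
    using that same[OF glue_vec_inner(3)] unfolding G3_def by blast
  have set: "example_set = P \<union> G1 \<union> G2 \<union> G3" unfolding example_set_def P_def G1_def G2_def G3_def ..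
  have J: "J u v \<or> J v u" if "u \<in> example_set" "v \<in> example_set" "u \<noteq> v" for u v
    using that PP P1 P2 P3 11 12 13 22 23 33 unfolding set by (elim UnE) blast+
  have "f (s, a, b) \<bullet> f (s, a, b) = 3"
    if "\<And>s a b s' a' b'. f (s, a, b) \<bullet> f (s', a', b') = s \<bullet> s' + (a * a' + b * b' + 1) / 2"
      and "(s, a, b) \<in> example_glue" for f :: "_ \<Rightarrow> R26" and s a b
    unfolding that(1) using g[OF that(2)] half_signs_inner_self[of s] by auto
  note norm = this[OF glue_vec_inner(1)] this[OF glue_vec_inner(2)] this[OF glue_vec_inner(3)]
  have "u \<bullet> rho = 1 \<and> u \<bullet> u = 3" if "u \<in> example_set" for u
    using that unfolding set
  proof (elim UnE)
    assume "u \<in> P"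
    then obtain i j where u: "u = triple_vec 1 (i, j, - (i + j))" unfolding P_def by auto
    show ?thesis unfolding u triple_vec_inner by (simp add: triple_vec.simps vec26_rho)
  next
    assume "u \<in> G1"
    then obtain s a b where u: "u = glue_vec1 (s, a, b)" "(s, a, b) \<in> example_glue" unfolding G1_def by auto
    show ?thesis unfolding u(1) norm(1)[OF u(2)] by (simp add: glue_vec_simps vec26_rho)
  next
    assume "u \<in> G2"
    then obtain s a b where u: "u = glue_vec2 (s, a, b)" "(s, a, b) \<in> example_glue" unfolding G2_def by auto
    show ?thesis unfolding u(1) norm(2)[OF u(2)] by (simp add: glue_vec_simps vec26_rho)
  next
    assume "u \<in> G3"
    then obtain s a b where u: "u = glue_vec3 (s, a, b)" "(s, a, b) \<in> example_glue" unfolding G3_def by auto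
    show ?thesis unfolding u(1) norm(3)[OF u(2)] by (simp add: glue_vec_simps vec26_rho)
  qed
  moreover have "u \<bullet> v \<in> {0, 1}" if "u \<in> example_set" "v \<in> example_set" "u \<noteq> v" for u v
    using J[OF that] unfolding J_def by (elim disjE conjE)
  ultimately show ?thesis unfolding affine_equiangular3_def by simp
qed

lemma example_set_L: "example_set \<subseteq> L"
proof -
  have "glue_vec1 w \<in> L" "glue_vec2 w \<in> L" "glue_vec3 w \<in> L" if "w \<in> example_glue" for w
    by (rule glue_vec_L, rule subsetD[OF example_glue_half_signs that])+
  then show ?thesis using triple_vec_L unfolding example_set_def by auto
qed

lemma card_example_set: "card example_set = 57"
proof -
  let ?P = "range (\<lambda>(i, j). triple_vec 1 (i, j, - (i + j)))"
  have fin: "finite example_glue" using card_example_glue card_ge_0_finite by force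
  have "simplex_point i = simplex_point j \<Longrightarrow> i = j" for i j
    by (auto simp: simplex_point_def vec_eq_iff split: if_splits)
  then have "inj (\<lambda>(i, j). triple_vec 1 (i, j, - (i + j)))"
    by (auto intro!: injI simp: triple_vec.simps vec26_eq_iff)
  then have P: "card ?P = 36" by (simp add: card_image)
  have G: "card (glue_vec1 ` example_glue) = 7" "card (glue_vec2 ` example_glue) = 7"
    "card (glue_vec3 ` example_glue) = 7"
    using card_example_glue inj_glue_vec by (metis card_image inj_on_subset subset_UNIV)+
  \<comment> \<open>The positions of the zero \<open>A\<^sub>1\<close> coefficients tell the four
    kinds of vectors apart.\<close>
  have d: "a \<noteq> 0" "b \<noteq> 0" if "(s, a, b) \<in> example_glue" for s a b
    using that example_glue_half_signs by auto
  have "?P \<inter> glue_vec1 ` example_glue = {}"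
    "(?P \<union> glue_vec1 ` example_glue) \<inter> glue_vec2 ` example_glue = {}"
    "(?P \<union> glue_vec1 ` example_glue \<union> glue_vec2 ` example_glue) \<inter> glue_vec3 ` example_glue = {}"
    using d by (auto simp: glue_vec_simps triple_vec.simps vec26_eq_iff)
  then show ?thesis
    unfolding example_set_def using P G fin by (simp add: card_Un_disjoint)
qed

section \<open>Maximality\<close>

theorem theorem7p5:
  fixes \<omega> :: "R26 set"
  assumes "maximum_affine_equiangular3_in L rho \<omega>"
  shows "maximal_affine_equiangular3_in (span L) rho \<omega>"
proof -
  from assms have \<omega>: "affine_equiangular3 rho \<omega>" and L: "\<omega> \<subseteq> L"
    and max: "\<not> \<omega> \<prec> example_set"
    using example_set_equiangular example_set_L unfolding maximum_affine_equiangular3_in_def by blast+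
  \<comment> \<open>Otherwise the example would be strictly larger in the sense of
    \<open>\<prec>\<close>, against the choice of \<omega>.\<close>
  have "57 \<le> card \<omega>"
  proof (rule ccontr)
    assume less: "\<not> 57 \<le> card \<omega>"
    have "finite example_set" using card_example_set card_ge_0_finite by force
    moreover have "finite \<omega>" by (rule card_affine_equiangular_L(1)[OF \<omega> L])
    moreover have lt: "card \<omega> < card example_set" using less by (simp add: card_example_set)
    ultimately have "\<exists>f. f ` \<omega> \<subseteq> example_set \<and> inj_on f \<omega>" by (intro card_le_inj) simp_all
    then have "\<omega> \<lesssim> example_set" unfolding lepoll_def by blast
    moreover have "\<not> \<omega> \<approx> example_set"
      using lt bij_betw_same_card unfolding eqpoll_def by (metis less_irrefl)
    ultimately show False using max unfolding lesspoll_def by blast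
  qed
  moreover have "card (triple_part \<omega>) \<le> 36" "card (glue_part glue_vec1 \<omega>) \<le> 7"
    "card (glue_part glue_vec2 \<omega>) \<le> 7" "card (glue_part glue_vec3 \<omega>) \<le> 7"
    using card_triple_part(4)[OF \<omega>] glue_config_card_le[OF glue_parts_config(1)[OF \<omega>]]
      glue_config_card_le[OF glue_parts_config(2)[OF \<omega>]] glue_config_card_le[OF glue_parts_config(3)[OF \<omega>]]
    by simp_all
  \<comment> \<open>Since 57 = 36 + 7 + 7 + 7, all four bounds are attained.\<close>
  ultimately have cards: "card (triple_part \<omega>) = 36" "card (glue_part glue_vec1 \<omega>) = 7"
    "card (glue_part glue_vec2 \<omega>) = 7" "card (glue_part glue_vec3 \<omega>) = 7"
    using card_affine_equiangular_L(2)[OF \<omega> L] by linarith+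
  have "\<not> \<omega> \<subset> \<omega>'" if \<omega>': "affine_equiangular3 rho \<omega>'" "\<omega>' \<subseteq> span L" for \<omega>'
  proof
    assume "\<omega> \<subset> \<omega>'"
    then obtain x where x: "x \<in> \<omega>'" "x \<notin> \<omega>" and sub: "\<omega> \<subseteq> \<omega>'" by blast
    show False
    proof (rule no_extension[OF \<omega> cards])
      show "x \<in> span L" using x(1) \<omega>'(2) by blast
      show "x \<bullet> rho = 1" "x \<bullet> x = 3" using x(1) \<omega>'(1) unfolding affine_equiangular3_def by simp_all
      show "x \<bullet> u \<in> {0, 1}" if "u \<in> \<omega>" for u
        using affine_equiangular3_inner[OF \<omega>'(1) x(1), of u] sub x(2) that by auto
    qed
  qed
  moreover have "\<omega> \<subseteq> span L" using L span_superset by blast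
  ultimately show ?thesis using \<omega> unfolding maximal_affine_equiangular3_in_def by blast
qed

end
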